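(* Consider the system $\dot\chi=f(\chi)$, $y=h(\chi)$, with $\chi\in\mathbb R^n$, $y\in\mathbb R$, and $f$, $h$ smooth. There exists a nonlinear diffeomorphism $z=\Phi(\chi)$ transforming the system into the observer canonical form (i.e. the system can achieve observer error linearization) on a region $\mathcal U$ if and only if: 1) the codistribution $\Delta^\perp=\operatorname{span}\{\mathrm dh(\chi),\mathrm dL_fh(\chi),\ldots,\mathrm dL_f^{n-1}h(\chi)\}$ has dimension $n$ on $\mathcal U$; and 2) the function $p(x)=L_f^nh(\chi)\big|_{\chi=\Psi^{-1}(x)}$ satisfies the Pascal-Hessian condition on the region $\Psi(\mathcal U)$, where $x=\Psi(\chi)$ is given by $x_1=h(\chi),\ x_2=L_fh(\chi),\ \ldots,\ x_n=L_f^{n-1}h(\chi)$.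
   Context: Lie derivatives: $L_fh=\frac{\partial h}{\partial\chi^\top}f$, $L_f^kh=L_f(L_f^{k-1}h)$. The dimension of $\Delta^\perp$ at a point is the rank of the matrix formed by the coefficient vectors of the $n$ covector fields spanning it. When $\Delta^\perp$ has dimension $n$ on $\mathcal U$, the map $x=\Psi(\chi)$ is taken as a diffeomorphism on $\mathcal U$, and it transforms the system into $\dot x_1=x_2,\ldots,\dot x_{n-1}=x_n,\ \dot x_n=p(x)$, $y=x_1$. Observer canonical form: the system $$\dot z=Az+\alpha(y),\qquad y=Cz=z_n,$$ i.e. $\dot z_1=\alpha_1(y)$, $\dot z_k=z_{k-1}+\alpha_k(y)$ for $k=2,\ldots,n$, $y=z_n$, where $\alpha_1,\ldots,\alpha_n$ are smooth univariate functions, $A$ is the $n\times n$ matrix with ones on the first subdiagonal and zeros elsewhere, and $C=[0\ \cdots\ 0\ 1]$. Pascal-Hessian condition: $p$ satisfies it on a region if, on that region, for all $1\le i,j\le n$, $$\frac{\partial^2p}{\partial x_i\partial x_j}=\begin{cases}\displaystyle\binom{i+j-2}{i-1}\frac{\partial^2p}{\partial x_1\partial x_{i+j-1}}, & i+j-1\le n,\\[1ex] 0,& i+j-1>n.\end{cases}$$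
   Formalization: For a single Φ on all of U, the "if" direction is proved only when the level sets of h in U are connected (it fails otherwise); for every region U the equivalence is proved with Φ existing near each point of U. The functions α_k are smooth on the output values h(U). *)

theory Defs
  imports "HOL-Analysis.Analysis"
begin

text \<open>
  Vectors of \<open>\<real>\<^sup>n\<close> are elements of \<open>real ^ 'n\<close>, with \<open>n = CARD('n)\<close>.
  A bijection \<open>ix\<close> from \<open>{1..n}\<close> to the index type fixes the order of the coordinates:
  the \<open>k\<close>-th coordinate of \<open>x\<close> is \<open>x $ ix k\<close>.
\<close>

definition vec_of :: "(nat \<Rightarrow> 'n::finite) \<Rightarrow> (nat \<Rightarrow> real) \<Rightarrow> real ^ 'n" where
  "vec_of ix g = (\<chi> i. g (inv_into {1..CARD('n)} ix i))"

definition mat_of :: "(nat \<Rightarrow> 'n::finite) \<Rightarrow> (nat \<Rightarrow> nat \<Rightarrow> real) \<Rightarrow> real ^ 'n ^ 'n" where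
  "mat_of ix M = (\<chi> i j. M (inv_into {1..CARD('n)} ix i) (inv_into {1..CARD('n)} ix j))"

text \<open>
  \<open>C\<^sup>k\<close> and smooth functions. The derivatives are two-sided (\<open>at x\<close>, not \<open>at x within S\<close>),
  so the notion is meant for open \<open>S\<close>, and values outside \<open>S\<close> are irrelevant for such \<open>S\<close>.
\<close>

primrec Ck_on ::
  "nat \<Rightarrow> 'a::real_normed_vector set \<Rightarrow> ('a \<Rightarrow> 'b::real_normed_vector) \<Rightarrow> bool" where
  "Ck_on 0 S g \<longleftrightarrow> continuous_on S g"
| "Ck_on (Suc k) S g \<longleftrightarrow> (\<forall>x\<in>S. g differentiable (at x)) \<and>
     (\<forall>v. Ck_on k S (\<lambda>x. frechet_derivative g (at x) v))"

definition smooth_on ::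
  "'a::real_normed_vector set \<Rightarrow> ('a \<Rightarrow> 'b::real_normed_vector) \<Rightarrow> bool" where
  "smooth_on S g \<longleftrightarrow> (\<forall>k. Ck_on k S g)"

definition diffeomorphism_on ::
  "'a::real_normed_vector set \<Rightarrow> ('a \<Rightarrow> 'b::real_normed_vector) \<Rightarrow> bool" where
  "diffeomorphism_on U \<Phi> \<longleftrightarrow> open U \<and> open (\<Phi> ` U) \<and> smooth_on U \<Phi> \<and>
     (\<exists>g. homeomorphism U (\<Phi> ` U) \<Phi> g \<and> smooth_on (\<Phi> ` U) g)"

definition region :: "'a::topological_space set \<Rightarrow> bool" where
  "region U \<longleftrightarrow> open U \<and> connected U"

definition partial_deriv :: "'n::finite \<Rightarrow> (real ^ 'n \<Rightarrow> real) \<Rightarrow> real ^ 'n \<Rightarrow> real" where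
  "partial_deriv i g x = frechet_derivative g (at x) (axis i 1)"

definition lie_deriv ::
  "(real ^ 'n \<Rightarrow> real ^ 'n) \<Rightarrow> (real ^ 'n \<Rightarrow> real) \<Rightarrow> real ^ 'n::finite \<Rightarrow> real" where
  "lie_deriv f h \<xi> = (\<Sum>i\<in>UNIV. partial_deriv i h \<xi> * f \<xi> $ i)"

definition lie_pow ::
  "nat \<Rightarrow> (real ^ 'n \<Rightarrow> real ^ 'n) \<Rightarrow> (real ^ 'n \<Rightarrow> real) \<Rightarrow> real ^ 'n::finite \<Rightarrow> real" where
  "lie_pow k f h = (lie_deriv f ^^ k) h"

text \<open>
  Row \<open>k\<close> of this matrix is the coefficient vector of the covector field \<open>dL\<^sub>f\<^sup>k\<^sup>-\<^sup>1h\<close>.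
\<close>

definition codistribution_matrix ::
  "(nat \<Rightarrow> 'n::finite) \<Rightarrow> (real ^ 'n \<Rightarrow> real ^ 'n) \<Rightarrow> (real ^ 'n \<Rightarrow> real) \<Rightarrow>
   real ^ 'n \<Rightarrow> real ^ 'n ^ 'n" where
  "codistribution_matrix ix f h \<xi> =
     mat_of ix (\<lambda>k l. partial_deriv (ix l) (lie_pow (k - 1) f h) \<xi>)"

definition codistribution_full_on ::
  "(nat \<Rightarrow> 'n::finite) \<Rightarrow> (real ^ 'n \<Rightarrow> real ^ 'n) \<Rightarrow> (real ^ 'n \<Rightarrow> real) \<Rightarrow>
   (real ^ 'n) set \<Rightarrow> bool" where
  "codistribution_full_on ix f h U \<longleftrightarrow>
     (\<forall>\<xi>\<in>U. rank (codistribution_matrix ix f h \<xi>) = CARD('n))"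

definition obs_map ::
  "(nat \<Rightarrow> 'n::finite) \<Rightarrow> (real ^ 'n \<Rightarrow> real ^ 'n) \<Rightarrow> (real ^ 'n \<Rightarrow> real) \<Rightarrow>
   real ^ 'n \<Rightarrow> real ^ 'n" where
  "obs_map ix f h \<xi> = vec_of ix (\<lambda>k. lie_pow (k - 1) f h \<xi>)"

text \<open>
  The function \<open>p\<close>; it is meaningful on the image of \<open>U\<close> when \<open>obs_map ix f h\<close> is injective on \<open>U\<close>.
\<close>

definition obs_p ::
  "(nat \<Rightarrow> 'n::finite) \<Rightarrow> (real ^ 'n \<Rightarrow> real ^ 'n) \<Rightarrow> (real ^ 'n \<Rightarrow> real) \<Rightarrow>
   (real ^ 'n) set \<Rightarrow> real ^ 'n \<Rightarrow> real" where
  "obs_p ix f h U x = lie_pow CARD('n) f h (inv_into U (obs_map ix f h) x)"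

definition pascal_hessian_on ::
  "(nat \<Rightarrow> 'n::finite) \<Rightarrow> (real ^ 'n) set \<Rightarrow> (real ^ 'n \<Rightarrow> real) \<Rightarrow> bool" where
  "pascal_hessian_on ix S p \<longleftrightarrow>
     (\<forall>x\<in>S. \<forall>i\<in>{1..CARD('n)}. \<forall>j\<in>{1..CARD('n)}.
        partial_deriv (ix i) (partial_deriv (ix j) p) x =
          (if i + j - 1 \<le> CARD('n)
           then real ((i + j - 2) choose (i - 1)) *
                partial_deriv (ix 1) (partial_deriv (ix (i + j - 1)) p) x
           else 0))"

definition ocf_A :: "(nat \<Rightarrow> 'n::finite) \<Rightarrow> real ^ 'n ^ 'n" where
  "ocf_A ix = mat_of ix (\<lambda>k l. if k = l + 1 then 1 else 0)"

definition ocf_C :: "(nat \<Rightarrow> 'n::finite) \<Rightarrow> real ^ 'n" where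
  "ocf_C ix = vec_of ix (\<lambda>k. if k = CARD('n) then 1 else 0)"

text \<open>
  \<open>\<Phi>\<close> carries the vector field \<open>f\<close> to \<open>z \<mapsto> A z + \<alpha>(y)\<close> and the output \<open>h\<close> to \<open>y = C z\<close>.
  The functions \<open>\<alpha>\<^sub>k\<close> have to be smooth where the output takes its values, i.e. on \<open>h ` U\<close>
  (which is open, \<open>h\<close> being the last component of a diffeomorphism); they need not extend
  smoothly beyond it.
\<close>

definition transforms_to_ocf ::
  "(nat \<Rightarrow> 'n::finite) \<Rightarrow> (real ^ 'n \<Rightarrow> real ^ 'n) \<Rightarrow> (real ^ 'n \<Rightarrow> real) \<Rightarrow>
   (real ^ 'n) set \<Rightarrow> (real ^ 'n \<Rightarrow> real ^ 'n) \<Rightarrow> bool" where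
  "transforms_to_ocf ix f h U \<Phi> \<longleftrightarrow>
     (\<exists>\<alpha> :: nat \<Rightarrow> real \<Rightarrow> real.
        (\<forall>k\<in>{1..CARD('n)}. smooth_on (h ` U) (\<alpha> k)) \<and>
        (\<forall>\<xi>\<in>U. frechet_derivative \<Phi> (at \<xi>) (f \<xi>) =
                  ocf_A ix *v \<Phi> \<xi> + vec_of ix (\<lambda>k. \<alpha> k (h \<xi>)) \<and>
                h \<xi> = ocf_C ix \<bullet> \<Phi> \<xi>))"

text \<open>
  One \<open>\<Phi>\<close> and one family \<open>\<alpha>\<close> for all of \<open>U\<close>. As \<open>\<alpha>\<close> is a single-valued function of the output,
  two components of a level set of \<open>h\<close> in \<open>U\<close> share the same values of \<open>\<alpha>\<close>; a pointwise condition on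
  derivatives cannot enforce this unless the level sets of \<open>h\<close> in \<open>U\<close> are connected.
\<close>

definition achieves_oel_on ::
  "(nat \<Rightarrow> 'n::finite) \<Rightarrow> (real ^ 'n \<Rightarrow> real ^ 'n) \<Rightarrow> (real ^ 'n \<Rightarrow> real) \<Rightarrow>
   (real ^ 'n) set \<Rightarrow> bool" where
  "achieves_oel_on ix f h U \<longleftrightarrow>
     (\<exists>\<Phi>. diffeomorphism_on U \<Phi> \<and> transforms_to_ocf ix f h U \<Phi>)"

end

theory Submission
  imports Defs
begin

text \<open>
  Let \<open>D\<close> be the total time derivative along \<open>x\<^sub>i' = x\<^sub>i\<^sub>+\<^sub>1\<close>. Eliminating the states of the observer
  canonical form one after the other shows that the system has this form exactly when
  \<open>p = \<Sum>\<^sub>k D\<^sup>k\<^sup>-\<^sup>1 (\<alpha>\<^sub>k(x\<^sub>1))\<close>, the transformation being a triangular map in the coordinates \<open>x\<close>.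
  Such sums satisfy the Pascal-Hessian condition because
  \<open>\<partial>\<^sub>j D\<^sup>m (\<alpha>(x\<^sub>1)) = (m choose (j - 1)) D\<^sup>m\<^sup>-\<^sup>j\<^sup>+\<^sup>1 (\<alpha>'(x\<^sub>1))\<close>.
  Conversely, the condition for \<open>j = n\<close> makes \<open>\<partial>\<^sub>n p\<close> a function of \<open>x\<^sub>1\<close> alone, constant on each
  connected slice; its antiderivative is \<open>\<alpha>\<^sub>n\<close>. Subtracting \<open>D\<^sup>n\<^sup>-\<^sup>1 (\<alpha>\<^sub>n(x\<^sub>1))\<close> from \<open>p\<close> preserves the
  condition and removes the dependence on \<open>x\<^sub>n\<close>, so one recurses downwards. Locally the slices are
  made connected by taking the preimage of a ball in the coordinates \<open>x\<close>.
\<close>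

section \<open>Smooth functions\<close>

lemma Ck_on_cong:
  assumes "open S" "\<And>x. x \<in> S \<Longrightarrow> g x = g' x" "Ck_on k S g"
  shows "Ck_on k S g'"
  using assms(2,3)
proof (induction k arbitrary: g g')
  case 0
  then show ?case by (simp cong: continuous_on_cong)
next
  case (Suc k)
  have diff: "g differentiable at x" if "x \<in> S" for x
    using Suc.prems(2) that by simp
  have "g' differentiable at x" if "x \<in> S" for x
    using diff[OF that] has_derivative_transform_within_open[OF _ \<open>open S\<close> that] Suc.prems(1)
    unfolding differentiable_def by metis
  moreover have "frechet_derivative g (at x) v = frechet_derivative g' (at x) v" if "x \<in> S" for x v
    using frechet_derivative_transform_within_open[OF diff[OF that] \<open>open S\<close> that] Suc.prems(1) by simp
  then have "Ck_on k S (\<lambda>x. frechet_derivative g' (at x) v)" for v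
    using Suc.IH[of "\<lambda>x. frechet_derivative g (at x) v"] Suc.prems(2) by simp
  ultimately show ?case by simp
qed

lemma Ck_on_subset: "Ck_on k S g \<Longrightarrow> T \<subseteq> S \<Longrightarrow> Ck_on k T g"
  by (induction k arbitrary: g) (auto intro: continuous_on_subset)

lemma Ck_on_SucD: "Ck_on (Suc k) S g \<Longrightarrow> Ck_on k S g"
proof (induction k arbitrary: g)
  case 0
  then show ?case
    by (auto intro!: continuous_at_imp_continuous_on differentiable_imp_continuous_within)
qed simp

lemma Ck_on_const: "Ck_on k S (\<lambda>x. c)"
  by (induction k arbitrary: c) auto

lemma Ck_on_locally:
  assumes "\<And>x. x \<in> S \<Longrightarrow> \<exists>T. open T \<and> x \<in> T \<and> Ck_on k T g"
  shows "Ck_on k S g"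
  using assms
proof (induction k arbitrary: g)
  case 0
  have "isCont g x" if x: "x \<in> S" for x
    using 0[OF x] by (auto simp: continuous_on_eq_continuous_at)
  then show ?case by (simp add: continuous_at_imp_continuous_on)
next
  case (Suc k)
  have "Ck_on k S (\<lambda>x. frechet_derivative g (at x) v)" for v
    by (rule Suc.IH) (use Suc.prems in fastforce)
  moreover have "g differentiable at x" if "x \<in> S" for x
    using Suc.prems[OF that] by auto
  ultimately show ?case by simp
qed

lemma Ck_on_bounded_linear:
  assumes "bounded_linear L" "open S" "Ck_on k S g"
  shows "Ck_on k S (\<lambda>x. L (g x))"
  using assms(3)
proof (induction k arbitrary: g)
  case 0
  then show ?case using assms(1) by (simp add: bounded_linear.continuous_on)
next
  case (Suc k)
  have D: "((\<lambda>x. L (g x)) has_derivative (\<lambda>v. L (frechet_derivative g (at x) v))) (at x)"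
    if "x \<in> S" for x
    using Suc.prems that
    by (intro bounded_linear.has_derivative[OF assms(1)]) (simp add: frechet_derivative_works[symmetric])
  have "Ck_on k S (\<lambda>x. frechet_derivative (\<lambda>x. L (g x)) (at x) v)" for v
    by (rule Ck_on_cong[OF assms(2) _ Suc.IH[of "\<lambda>x. frechet_derivative g (at x) v"]])
      (use Suc.prems frechet_derivative_at[OF D] in \<open>auto simp: fun_eq_iff\<close>)
  then show ?case using D by (auto simp: differentiable_def)
qed

lemma Ck_on_add:
  assumes "open S" "Ck_on k S g" "Ck_on k S g'"
  shows "Ck_on k S (\<lambda>x. g x + g' x)"
  using assms(2,3)
proof (induction k arbitrary: g g')
  case 0
  then show ?case by (simp add: continuous_on_add)
next
  case (Suc k)
  have D: "((\<lambda>x. g x + g' x) has_derivative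
      (\<lambda>v. frechet_derivative g (at x) v + frechet_derivative g' (at x) v)) (at x)"
    if "x \<in> S" for x
    using Suc.prems that
    by (intro has_derivative_add) (simp_all add: frechet_derivative_works[symmetric])
  have "Ck_on k S (\<lambda>x. frechet_derivative (\<lambda>x. g x + g' x) (at x) v)" for v
    by (rule Ck_on_cong[OF assms(1) _ Suc.IH[of "\<lambda>x. frechet_derivative g (at x) v"
            "\<lambda>x. frechet_derivative g' (at x) v"]])
      (use Suc.prems frechet_derivative_at[OF D] in \<open>auto simp: fun_eq_iff\<close>)
  then show ?case using D by (auto simp: differentiable_def)
qed

lemma Ck_on_sum:
  assumes "open S" "\<And>i. i \<in> A \<Longrightarrow> Ck_on k S (g i)"
  shows "Ck_on k S (\<lambda>x. \<Sum>i\<in>A. g i x)"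
  using assms(2)
  by (induction A rule: infinite_finite_induct) (auto intro: Ck_on_const Ck_on_add[OF assms(1)])

lemma Ck_on_bilinear:
  assumes "bounded_bilinear B" "open S" "Ck_on k S g" "Ck_on k S g'"
  shows "Ck_on k S (\<lambda>x. B (g x) (g' x))"
  using assms(3,4)
proof (induction k arbitrary: g g')
  case 0
  then show ?case using bounded_bilinear.continuous_on[OF assms(1)] by simp
next
  case (Suc k)
  have D: "((\<lambda>x. B (g x) (g' x)) has_derivative
      (\<lambda>v. B (g x) (frechet_derivative g' (at x) v) + B (frechet_derivative g (at x) v) (g' x))) (at x)"
    if "x \<in> S" for x
    using Suc.prems that
    by (intro bounded_bilinear.FDERIV[OF assms(1)]) (simp_all add: frechet_derivative_works[symmetric])
  have "Ck_on k S (\<lambda>x. frechet_derivative (\<lambda>x. B (g x) (g' x)) (at x) v)" for v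
    by (rule Ck_on_cong[OF assms(2) _ Ck_on_add[OF assms(2)
            Suc.IH[of g "\<lambda>x. frechet_derivative g' (at x) v"]
            Suc.IH[of "\<lambda>x. frechet_derivative g (at x) v" g']]])
      (use Suc.prems Ck_on_SucD frechet_derivative_at[OF D] in \<open>auto simp: fun_eq_iff\<close>)
  then show ?case using D by (auto simp: differentiable_def)
qed

lemma frechet_derivative_Basis:
  fixes g :: "'b::euclidean_space \<Rightarrow> 'c::real_normed_vector"
  assumes "g differentiable at x"
  shows "frechet_derivative g (at x) v = (\<Sum>b\<in>Basis. (v \<bullet> b) *\<^sub>R frechet_derivative g (at x) b)"
proof -
  have "frechet_derivative g (at x) v = frechet_derivative g (at x) (\<Sum>b\<in>Basis. (v \<bullet> b) *\<^sub>R b)"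
    by (simp add: euclidean_representation)
  then show ?thesis
    using linear_frechet_derivative[OF assms] by (simp add: linear_sum linear_scale)
qed

lemma Ck_on_compose:
  fixes g :: "'b::euclidean_space \<Rightarrow> 'c::real_normed_vector"
  assumes "open S" "Ck_on k S \<phi>" "Ck_on k T g" "\<phi> ` S \<subseteq> T"
  shows "Ck_on k S (\<lambda>x. g (\<phi> x))"
  using assms(2-4)
proof (induction k arbitrary: g \<phi>)
  case 0
  then show ?case by (auto intro: continuous_on_compose2)
next
  case (Suc k)
  have dg: "g differentiable at (\<phi> x)" if "x \<in> S" for x
    using Suc.prems that by (auto simp: image_subset_iff)
  have D: "((\<lambda>x. g (\<phi> x)) has_derivative
      (\<lambda>v. frechet_derivative g (at (\<phi> x)) (frechet_derivative \<phi> (at x) v))) (at x)"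
    if "x \<in> S" for x
    by (rule has_derivative_compose[where g = g])
      (use Suc.prems(1) that dg[OF that] in \<open>simp_all add: frechet_derivative_works[symmetric]\<close>)
  have "Ck_on k S (\<lambda>x. frechet_derivative (\<lambda>x. g (\<phi> x)) (at x) v)" for v
  proof (rule Ck_on_cong[OF assms(1)])
    show "Ck_on k S (\<lambda>x. \<Sum>b\<in>Basis. (frechet_derivative \<phi> (at x) v \<bullet> b) *\<^sub>R frechet_derivative g (at (\<phi> x)) b)"
    proof (intro Ck_on_sum Ck_on_bilinear[OF bounded_bilinear_scaleR] assms(1))
      show "Ck_on k S (\<lambda>x. frechet_derivative \<phi> (at x) v \<bullet> b)" for b
        using Suc.prems by (intro Ck_on_bounded_linear[OF bounded_linear_inner_left] assms(1)) simp
      show "Ck_on k S (\<lambda>x. frechet_derivative g (at (\<phi> x)) b)" for b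
        using Ck_on_SucD[OF Suc.prems(1)] Suc.prems(2,3)
        by (intro Suc.IH[where g = "\<lambda>y. frechet_derivative g (at y) b"]) auto
    qed
  next
    fix x assume "x \<in> S"
    then show "(\<Sum>b\<in>Basis. (frechet_derivative \<phi> (at x) v \<bullet> b) *\<^sub>R frechet_derivative g (at (\<phi> x)) b)
        = frechet_derivative (\<lambda>x. g (\<phi> x)) (at x) v"
      using frechet_derivative_at[OF D] frechet_derivative_Basis[OF dg] by (simp add: fun_eq_iff)
  qed
  then show ?case using D by (auto simp: differentiable_def)
qed

lemma smooth_on_cong: "open S \<Longrightarrow> (\<And>x. x \<in> S \<Longrightarrow> g x = g' x) \<Longrightarrow> smooth_on S g \<Longrightarrow> smooth_on S g'"
  unfolding smooth_on_def by (blast intro: Ck_on_cong)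

lemma smooth_on_subset: "smooth_on S g \<Longrightarrow> T \<subseteq> S \<Longrightarrow> smooth_on T g"
  unfolding smooth_on_def by (blast intro: Ck_on_subset)

lemma smooth_on_const: "smooth_on S (\<lambda>x. c)"
  by (simp add: smooth_on_def Ck_on_const)

lemma smooth_on_ident: "smooth_on S (\<lambda>x. x)"
proof -
  have "Ck_on k S (\<lambda>x. x)" for k by (cases k) (auto simp: Ck_on_const)
  then show ?thesis by (simp add: smooth_on_def)
qed

lemma smooth_on_locally:
  assumes "\<And>x. x \<in> S \<Longrightarrow> \<exists>T. open T \<and> x \<in> T \<and> smooth_on T g"
  shows "smooth_on S g"
  unfolding smooth_on_def
proof
  show "Ck_on k S g" for k
    by (rule Ck_on_locally) (use assms in \<open>auto simp: smooth_on_def\<close>)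
qed

lemma smooth_on_bounded_linear:
  "bounded_linear L \<Longrightarrow> open S \<Longrightarrow> smooth_on S g \<Longrightarrow> smooth_on S (\<lambda>x. L (g x))"
  by (simp add: smooth_on_def Ck_on_bounded_linear)

lemma smooth_on_add:
  "open S \<Longrightarrow> smooth_on S g \<Longrightarrow> smooth_on S g' \<Longrightarrow> smooth_on S (\<lambda>x. g x + g' x)"
  by (simp add: smooth_on_def Ck_on_add)

lemma smooth_on_sum:
  "open S \<Longrightarrow> (\<And>i. i \<in> A \<Longrightarrow> smooth_on S (g i)) \<Longrightarrow> smooth_on S (\<lambda>x. \<Sum>i\<in>A. g i x)"
  by (simp add: smooth_on_def Ck_on_sum)

lemma smooth_on_scaleR:
  "open S \<Longrightarrow> smooth_on S g \<Longrightarrow> smooth_on S g' \<Longrightarrow> smooth_on S (\<lambda>x. g x *\<^sub>R g' x)"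
  by (simp add: smooth_on_def Ck_on_bilinear bounded_bilinear_scaleR)

lemma smooth_on_mult:
  fixes g g' :: "'a::real_normed_vector \<Rightarrow> real"
  shows "open S \<Longrightarrow> smooth_on S g \<Longrightarrow> smooth_on S g' \<Longrightarrow> smooth_on S (\<lambda>x. g x * g' x)"
  by (simp add: smooth_on_def Ck_on_bilinear bounded_bilinear_mult)

lemma smooth_on_diff:
  assumes "open S" "smooth_on S g" "smooth_on S g'"
  shows "smooth_on S (\<lambda>x. g x - g' x)"
  using smooth_on_add[OF assms(1,2) smooth_on_bounded_linear[OF bounded_linear_minus[OF bounded_linear_ident] assms(1,3)]]
  by simp

lemma smooth_on_compose:
  fixes g :: "'b::euclidean_space \<Rightarrow> 'c::real_normed_vector"
  assumes "open S" "smooth_on S \<phi>" "smooth_on T g" "\<phi> ` S \<subseteq> T"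
  shows "smooth_on S (\<lambda>x. g (\<phi> x))"
  unfolding smooth_on_def
proof
  show "Ck_on k S (\<lambda>x. g (\<phi> x))" for k
    by (rule Ck_on_compose[OF assms(1) _ _ assms(4)]) (use assms(2,3) in \<open>simp_all add: smooth_on_def\<close>)
qed

lemma smooth_on_differentiable:
  assumes "smooth_on S g" "x \<in> S"
  shows "g differentiable at x"
proof -
  have "Ck_on (Suc 0) S g" using assms(1) unfolding smooth_on_def by (rule spec)
  then show ?thesis using assms(2) by simp
qed

lemma smooth_on_frechet:
  assumes "smooth_on S g"
  shows "smooth_on S (\<lambda>x. frechet_derivative g (at x) v)"
  unfolding smooth_on_def
proof
  fix k
  have "Ck_on (Suc k) S g" using assms unfolding smooth_on_def by (rule spec)
  then show "Ck_on k S (\<lambda>x. frechet_derivative g (at x) v)" by simp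
qed

lemma smooth_on_continuous:
  assumes "smooth_on S g"
  shows "continuous_on S g"
proof -
  have "Ck_on 0 S g" using assms unfolding smooth_on_def by (rule spec)
  then show ?thesis by simp
qed

lemma smooth_on_integrate:
  assumes "open S" "\<And>x. x \<in> S \<Longrightarrow> (F has_derivative F' x) (at x)" "\<And>v. smooth_on S (\<lambda>x. F' x v)"
  shows "smooth_on S F"
proof -
  have "Ck_on (Suc k) S F" for k
  proof -
    have "Ck_on k S (\<lambda>x. frechet_derivative F (at x) v)" for v
      by (rule Ck_on_cong[OF assms(1), of "\<lambda>x. F' x v"])
        (use assms(3) frechet_derivative_at[OF assms(2)] in \<open>auto simp: smooth_on_def fun_eq_iff\<close>)
    then show ?thesis using assms(2) by (auto simp: differentiable_def)
  qed
  then show ?thesis by (simp add: smooth_on_def Ck_on_SucD del: Ck_on.simps)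
qed

lemma smooth_on_deriv:
  fixes a :: "real \<Rightarrow> real"
  assumes "open I" "smooth_on I a"
  shows "smooth_on I (deriv a)"
    and "\<And>t. t \<in> I \<Longrightarrow> (a has_real_derivative deriv a t) (at t)"
proof -
  show *: "(a has_real_derivative deriv a t) (at t)" if "t \<in> I" for t
    using smooth_on_differentiable[OF assms(2) that]
    by (metis DERIV_deriv_iff_real_differentiable)
  have "frechet_derivative a (at t) 1 = deriv a t" if "t \<in> I" for t
    using frechet_derivative_at[OF *[OF that, unfolded has_field_derivative_def]]
    by (metis mult.right_neutral)
  then show "smooth_on I (deriv a)"
    using smooth_on_cong[OF assms(1) _ smooth_on_frechet[OF assms(2), of 1]] by blast
qed

lemma smooth_antiderivative:
  fixes b :: "real \<Rightarrow> real"
  assumes "open I" "connected I" "smooth_on I b"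
  obtains a where "smooth_on I a" "\<And>t. t \<in> I \<Longrightarrow> (a has_real_derivative b t) (at t)"
proof (cases "I = {}")
  case True
  then show ?thesis using that[of b] assms(3) by simp
next
  case False
  define l u where "l = Inf (ereal ` I)" and "u = Sup (ereal ` I)"
  have I: "ereal t > l \<and> ereal t < u \<longleftrightarrow> t \<in> I" for t
  proof
    assume "l < ereal t \<and> ereal t < u"
    then obtain x y where "x \<in> I" "y \<in> I" "x < t" "t < y"
      by (auto simp: l_def u_def Inf_less_iff less_Sup_iff)
    then show "t \<in> I"
      using assms(2) connectedD_interval by (metis less_imp_le)
  next
    assume t: "t \<in> I"
    then obtain e where e: "e > 0" "ball t e \<subseteq> I"
      using assms(1) open_contains_ball by blast
    then have "t - e/2 \<in> I" "t + e/2 \<in> I" by (auto simp: dist_real_def)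
    then have "l \<le> ereal (t - e/2)" "ereal (t + e/2) \<le> u"
      by (auto simp: l_def u_def intro: Inf_lower Sup_upper)
    then show "l < ereal t \<and> ereal t < u"
      using e(1) by (metis add_less_cancel_left add.right_neutral diff_less_eq ereal_less(2)
          half_gt_zero le_less_trans less_ereal.simps(1) less_le_trans)
  qed
  have "l < u" using False I by (metis all_not_in_conv less_trans)
  moreover have "isCont b t" if "l < ereal t" "ereal t < u" for t
    using that I smooth_on_continuous[OF assms(3)] assms(1) continuous_on_eq_continuous_at by blast
  ultimately obtain a where "\<forall>t. l < ereal t \<longrightarrow> ereal t < u \<longrightarrow> (a has_vector_derivative b t) (at t)"
    using einterval_antiderivative[of l u b] by blast
  then have a: "(a has_real_derivative b t) (at t)" if "t \<in> I" for t
    using that I[of t] by (simp add: has_real_derivative_iff_has_vector_derivative)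
  have "smooth_on I a"
    by (rule smooth_on_integrate[OF assms(1), where F' = "\<lambda>t v. b t * v"])
      (use a assms in \<open>auto simp: has_field_derivative_def intro: smooth_on_mult smooth_on_const\<close>)
  then show ?thesis using that a by blast
qed

section \<open>Partial derivatives and jets of the output\<close>

lemma open_coordinate_cylinder: "open I \<Longrightarrow> open {x :: real ^ 'n::finite. x $ i \<in> I}"
  using open_vimage[of I "\<lambda>x. x $ i"] by (simp add: vimage_def continuous_intros)

lemma partial_deriv_eq: "(g has_derivative g') (at x) \<Longrightarrow> partial_deriv i g x = g' (axis i 1)"
  using frechet_derivative_at by (metis partial_deriv_def)

lemma partial_deriv_cong:
  assumes "open S" "x \<in> S" "\<And>y. y \<in> S \<Longrightarrow> g y = g' y" "g differentiable at x"
  shows "partial_deriv i g x = partial_deriv i g' x"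
  using frechet_derivative_transform_within_open[OF assms(4,1,2)] assms(3) by (simp add: partial_deriv_def)

lemma partial_deriv_const [simp]: "partial_deriv i (\<lambda>x. c) x = 0"
  by (simp add: partial_deriv_def)

lemma partial_deriv_cmult:
  assumes "g differentiable at x"
  shows "partial_deriv i (\<lambda>x. c * g x) x = c * partial_deriv i g x"
  using assms
  by (subst partial_deriv_eq[OF has_derivative_mult_right[of g "frechet_derivative g (at x)"]])
    (simp_all add: frechet_derivative_works[symmetric] partial_deriv_def)

lemma partial_deriv_diff:
  assumes "g differentiable at x" "g' differentiable at x"
  shows "partial_deriv i (\<lambda>x. g x - g' x) x = partial_deriv i g x - partial_deriv i g' x"
  using assms
  by (subst partial_deriv_eq[OF has_derivative_diff[of g "frechet_derivative g (at x)" _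
          g' "frechet_derivative g' (at x)"]])
    (simp_all add: frechet_derivative_works[symmetric] partial_deriv_def)

lemma partial_deriv_sum:
  assumes "\<And>l. l \<in> A \<Longrightarrow> g l differentiable at x"
  shows "partial_deriv i (\<lambda>x. \<Sum>l\<in>A. g l x) x = (\<Sum>l\<in>A. partial_deriv i (g l) x)"
  using assms
  by (subst partial_deriv_eq[OF has_derivative_sum[of A g "\<lambda>l. frechet_derivative (g l) (at x)"]])
    (simp_all add: frechet_derivative_works[symmetric] partial_deriv_def)

lemma partial_deriv_nth_mult:
  assumes "g differentiable at x"
  shows "partial_deriv i (\<lambda>x. x $ k * g x) x =
    x $ k * partial_deriv i g x + (if k = i then g x else 0)"
proof -
  have "((\<lambda>x. x $ k * g x) has_derivative
      (\<lambda>v. x $ k * frechet_derivative g (at x) v + v $ k * g x)) (at x)"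
    using assms
    by (intro has_derivative_mult bounded_linear_imp_has_derivative bounded_linear_vec_nth)
      (simp add: frechet_derivative_works)
  from partial_deriv_eq[OF this, of i] show ?thesis
    by (simp add: partial_deriv_def axis_def)
qed

lemma smooth_on_partial_deriv: "smooth_on S g \<Longrightarrow> smooth_on S (partial_deriv i g)"
  using smooth_on_frechet[of S g "axis i 1"] unfolding partial_deriv_def .

lemma smooth_on_nth: "open S \<Longrightarrow> smooth_on S (\<lambda>x :: real ^ 'n::finite. x $ i)"
  by (rule smooth_on_bounded_linear[OF bounded_linear_vec_nth _ smooth_on_ident])

lemma smooth_on_vec:
  fixes g :: "'a::real_normed_vector \<Rightarrow> real ^ 'n::finite"
  assumes "open S" "\<And>i. smooth_on S (\<lambda>x. g x $ i)"
  shows "smooth_on S g"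
proof -
  have "(\<lambda>x. \<Sum>i\<in>UNIV. (g x $ i) *\<^sub>R axis i (1::real)) = g"
    using basis_expansion[of "g _"] by (simp add: scalar_mult_eq_scaleR)
  moreover have "smooth_on S (\<lambda>x. \<Sum>i\<in>UNIV. (g x $ i) *\<^sub>R axis i (1::real))"
    by (rule smooth_on_sum[OF assms(1)], rule smooth_on_scaleR[OF assms(1,2) smooth_on_const])
  ultimately show ?thesis by simp
qed

lemma frechet_derivative_partial:
  fixes g :: "real ^ 'n::finite \<Rightarrow> real"
  assumes "g differentiable at x"
  shows "frechet_derivative g (at x) v = (\<Sum>i\<in>UNIV. v $ i * partial_deriv i g x)"
proof -
  have "frechet_derivative g (at x) v = frechet_derivative g (at x) (\<Sum>i\<in>UNIV. (v $ i) *\<^sub>R axis i (1::real))"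
    using basis_expansion[of v] by (simp add: scalar_mult_eq_scaleR)
  then show ?thesis
    using linear_frechet_derivative[OF assms] by (simp add: linear_sum linear_scale partial_deriv_def)
qed

lemma lie_deriv_frechet:
  "h differentiable at \<xi> \<Longrightarrow> lie_deriv f h \<xi> = frechet_derivative h (at \<xi>) (f \<xi>)"
  by (simp add: lie_deriv_def frechet_derivative_partial mult.commute)

lemma smooth_on_lie_pow:
  assumes "open S" "smooth_on S f" "smooth_on S h"
  shows "smooth_on S (lie_pow k f h)"
proof (induction k)
  case 0
  then show ?case using assms by (simp add: lie_pow_def)
next
  case (Suc k)
  have "smooth_on S (\<lambda>\<xi>. \<Sum>i\<in>UNIV. partial_deriv i (lie_pow k f h) \<xi> * f \<xi> $ i)"
    by (intro smooth_on_sum smooth_on_mult assms smooth_on_partial_deriv Suc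
        smooth_on_bounded_linear[OF bounded_linear_vec_nth])
  then show ?case by (simp add: lie_pow_def lie_deriv_def[abs_def])
qed

lemma lie_pow_0 [simp]: "lie_pow 0 f h = h"
  and lie_pow_Suc: "lie_pow (Suc k) f h = lie_deriv f (lie_pow k f h)"
  by (simp_all add: lie_pow_def)

text \<open>
  On functions of the first coordinates, the vector field
  \<open>x\<^sub>2 \<partial>\<^sub>1 + \<dots> + x\<^sub>n \<partial>\<^sub>n\<^sub>-\<^sub>1\<close> acts as the total time derivative along the transformed system,
  so \<open>jet ix m a\<close> stands for the \<open>m\<close>-th time derivative of \<open>a(x\<^sub>1)\<close>.
\<close>

primrec jet :: "(nat \<Rightarrow> 'n::finite) \<Rightarrow> nat \<Rightarrow> (real \<Rightarrow> real) \<Rightarrow> real ^ 'n \<Rightarrow> real" where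
  "jet ix 0 a = (\<lambda>x. a (x $ ix (Suc 0)))"
| "jet ix (Suc m) a =
     (\<lambda>x. \<Sum>l<CARD('n) - 1. x $ ix (Suc (Suc l)) * partial_deriv (ix (Suc l)) (jet ix m a) x)"

lemma smooth_on_jet:
  fixes ix :: "nat \<Rightarrow> 'n::finite"
  assumes "open I" "smooth_on I a"
  shows "smooth_on {x. x $ ix (Suc 0) \<in> I} (jet ix m a)"
proof (induction m)
  case 0
  have "smooth_on {x. x $ ix (Suc 0) \<in> I} (\<lambda>x. a (x $ ix (Suc 0)))"
    by (rule smooth_on_compose[OF _ smooth_on_nth assms(2)])
      (use open_coordinate_cylinder[OF assms(1)] in auto)
  then show ?case by simp
next
  case (Suc m)
  then show ?case
    using open_coordinate_cylinder[OF assms(1)]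
    by (auto intro!: smooth_on_sum smooth_on_mult smooth_on_partial_deriv smooth_on_nth)
qed

lemma jet_differentiable:
  "open I \<Longrightarrow> smooth_on I a \<Longrightarrow> x $ ix (Suc 0) \<in> I \<Longrightarrow> jet ix m a differentiable at x"
  by (rule smooth_on_differentiable[OF smooth_on_jet]) simp_all

lemma choose_mult_shift: "(m choose j) * ((m - j) choose i) = (m choose (i + j)) * ((i + j) choose j)"
proof (cases "i + j \<le> m")
  case True
  then show ?thesis using choose_mult[of j "i + j" m] by simp
next
  case False
  then show ?thesis by (cases "j \<le> m") (simp_all add: binomial_eq_0)
qed

locale coordinate_order =
  fixes ix :: "nat \<Rightarrow> 'n::finite"
  assumes bij_ix: "bij_betw ix {1..CARD('n)} UNIV"
begin

lemma bij_coord: "bij_betw (\<lambda>j. ix (Suc j)) {..<CARD('n)} UNIV"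
proof -
  have "bij_betw Suc {..<CARD('n)} {1..CARD('n)}"
    by (rule bij_betw_imageI) (auto simp: image_Suc_lessThan)
  from bij_betw_trans[OF this bij_ix] show ?thesis by (simp add: comp_def)
qed

lemma sum_coord: "(\<Sum>i\<in>UNIV. g i) = (\<Sum>j<CARD('n). g (ix (Suc j)))"
  using sum.reindex_bij_betw[OF bij_coord, of g] by simp

lemma coord_eq_iff: "j < CARD('n) \<Longrightarrow> l < CARD('n) \<Longrightarrow> ix (Suc j) = ix (Suc l) \<longleftrightarrow> j = l"
  using bij_coord by (auto simp: bij_betw_def inj_on_def)

lemma coord_cases: obtains j where "j < CARD('n)" "i = ix (Suc j)"
  using bij_coord by (metis UNIV_I bij_betw_def imageE lessThan_iff)

lemma vec_coord_eqI: "(\<And>j. j < CARD('n) \<Longrightarrow> x $ ix (Suc j) = y $ ix (Suc j)) \<Longrightarrow> x = y"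
  by (metis coord_cases vec_eq_iff)

lemma inv_into_coord [simp]: "j < CARD('n) \<Longrightarrow> inv_into {Suc 0..CARD('n)} ix (ix (Suc j)) = Suc j"
  using bij_ix by (intro inv_into_f_f) (auto simp: bij_betw_def)

lemma vec_of_coord [simp]: "j < CARD('n) \<Longrightarrow> vec_of ix g $ ix (Suc j) = g (Suc j)"
  by (simp add: vec_of_def)

lemma obs_map_coord [simp]: "j < CARD('n) \<Longrightarrow> obs_map ix f h \<xi> $ ix (Suc j) = lie_pow j f h \<xi>"
  by (simp add: obs_map_def)

text \<open>
  The induction hypothesis at \<open>m\<close> for \<open>a\<close> and at the smaller orders for \<open>a'\<close> also yields
  the symmetry of the second derivatives of the jets, so no theorem on mixed partials is needed.
\<close>

lemma partial_deriv_jet: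
  assumes "open I" "smooth_on I a" "x $ ix (Suc 0) \<in> I" "j < CARD('n)"
  shows "partial_deriv (ix (Suc j)) (jet ix m a) x = real (m choose j) * jet ix (m - j) (deriv a) x"
  using assms(2-4)
proof (induction m arbitrary: a x j rule: less_induct)
  case (less m a x j)
  let ?C = "{x. x $ ix (Suc 0) \<in> I}"
  have C: "open ?C" by (rule open_coordinate_cylinder[OF assms(1)])
  note a' = smooth_on_deriv[OF assms(1) less.prems(1)]
  show ?case
  proof (cases m)
    case 0
    have "((\<lambda>x. a (x $ ix (Suc 0))) has_derivative (\<lambda>v. deriv a (x $ ix (Suc 0)) * v $ ix (Suc 0))) (at x)"
      by (rule has_derivative_compose[OF bounded_linear_imp_has_derivative[OF bounded_linear_vec_nth]])
        (use a'(2)[OF less.prems(2)] in \<open>simp add: has_field_derivative_def\<close>)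
    from partial_deriv_eq[OF this, of "ix (Suc j)"] show ?thesis
      using coord_eq_iff[of 0 j] less.prems(3) 0 by (cases j) (auto simp: axis_def)
  next
    case (Suc m')
    have diff: "jet ix k b differentiable at y" if "smooth_on I b" "y \<in> ?C" for k b y
      by (rule jet_differentiable[OF assms(1) that(1)]) (use that(2) in simp)
    have first: "partial_deriv (ix (Suc l)) (jet ix m' a) y =
        real (m' choose l) * jet ix (m' - l) (deriv a) y" if "l < CARD('n)" "y \<in> ?C" for l y
      using less.IH[of m' a y l] less.prems(1) Suc that by simp
    have diffp: "partial_deriv (ix (Suc l)) (jet ix m' a) differentiable at x" for l
      using smooth_on_differentiable[OF smooth_on_partial_deriv[OF smooth_on_jet[OF assms(1) less.prems(1)]]]
        less.prems(2) by simp
    have second: "partial_deriv (ix (Suc j)) (partial_deriv (ix (Suc l)) (jet ix m' a)) x =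
        real ((m' choose l) * ((m' - l) choose j)) * jet ix (m' - l - j) (deriv (deriv a)) x"
      if l: "l < CARD('n)" for l
    proof -
      have "partial_deriv (ix (Suc j)) (partial_deriv (ix (Suc l)) (jet ix m' a)) x =
          partial_deriv (ix (Suc j)) (\<lambda>y. real (m' choose l) * jet ix (m' - l) (deriv a) y) x"
        by (rule partial_deriv_cong[OF C _ first[OF l] diffp]) (use less.prems(2) in simp_all)
      also have "\<dots> = real (m' choose l) * partial_deriv (ix (Suc j)) (jet ix (m' - l) (deriv a)) x"
        by (rule partial_deriv_cmult[OF diff[OF a'(1)]]) (use less.prems(2) in simp)
      also have "partial_deriv (ix (Suc j)) (jet ix (m' - l) (deriv a)) x =
          real ((m' - l) choose j) * jet ix (m' - l - j) (deriv (deriv a)) x"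
        by (rule less.IH) (use Suc a' less.prems in auto)
      finally show ?thesis by simp
    qed
    have "partial_deriv (ix (Suc j)) (jet ix m a) x = (\<Sum>l<CARD('n) - 1.
        partial_deriv (ix (Suc j)) (\<lambda>x. x $ ix (Suc (Suc l)) * partial_deriv (ix (Suc l)) (jet ix m' a) x) x)"
      unfolding Suc jet.simps using diffp bounded_linear_imp_differentiable[OF bounded_linear_vec_nth]
      by (intro partial_deriv_sum) (auto intro!: differentiable_mult)
    also have "\<dots> = (\<Sum>l<CARD('n) - 1.
        x $ ix (Suc (Suc l)) * real ((m' choose l) * ((m' - l) choose j)) * jet ix (m' - l - j) (deriv (deriv a)) x
        + (if j = Suc l then real (m' choose l) * jet ix (m' - l) (deriv a) x else 0))"
    proof (rule sum.cong[OF refl])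
      fix l assume "l \<in> {..<CARD('n) - 1}"
      then have l: "l < CARD('n)" "Suc l < CARD('n)" by auto
      show "partial_deriv (ix (Suc j)) (\<lambda>x. x $ ix (Suc (Suc l)) * partial_deriv (ix (Suc l)) (jet ix m' a) x) x =
        x $ ix (Suc (Suc l)) * real ((m' choose l) * ((m' - l) choose j)) * jet ix (m' - l - j) (deriv (deriv a)) x
        + (if j = Suc l then real (m' choose l) * jet ix (m' - l) (deriv a) x else 0)"
        using partial_deriv_nth_mult[OF diffp] second[OF l(1)] first[OF l(1)] less.prems(2)
          coord_eq_iff[OF l(2) less.prems(3)] by auto
    qed
    also have "\<dots> = (\<Sum>l<CARD('n) - 1.
        x $ ix (Suc (Suc l)) * real ((m' choose l) * ((m' - l) choose j)) * jet ix (m' - l - j) (deriv (deriv a)) x)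
        + (\<Sum>l<CARD('n) - 1. if j = Suc l then real (m' choose l) * jet ix (m' - l) (deriv a) x else 0)"
      by (rule sum.distrib)
    also have "(\<Sum>l<CARD('n) - 1. if j = Suc l then real (m' choose l) * jet ix (m' - l) (deriv a) x else 0)
        = (case j of 0 \<Rightarrow> 0 | Suc i \<Rightarrow> real (m' choose i) * jet ix (m' - i) (deriv a) x)"
      using less.prems(3) by (auto split: nat.split)
    also have "(\<Sum>l<CARD('n) - 1.
        x $ ix (Suc (Suc l)) * real ((m' choose l) * ((m' - l) choose j)) * jet ix (m' - l - j) (deriv (deriv a)) x)
        = real (m' choose j) * jet ix (Suc m' - j) (deriv a) x"
    proof (cases "j \<le> m'")
      case True
      have "jet ix (Suc (m' - j)) (deriv a) x = (\<Sum>l<CARD('n) - 1. x $ ix (Suc (Suc l)) *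
          (real ((m' - j) choose l) * jet ix (m' - j - l) (deriv (deriv a)) x))"
        unfolding jet.simps using less.IH[of "m' - j" "deriv a" x] a' less.prems Suc
        by (intro sum.cong refl) auto
      moreover have "(m' choose l) * ((m' - l) choose j) = (m' choose j) * ((m' - j) choose l)" for l
        using choose_mult_shift[of m' l j] choose_mult_shift[of m' j l]
          binomial_symmetric[of l "j + l"] by (simp add: add.commute)
      ultimately show ?thesis
        using True by (simp add: Suc_diff_le sum_distrib_left mult_ac add.commute)
    next
      case False
      then show ?thesis by (simp add: binomial_eq_0)
    qed
    finally show ?thesis
      unfolding Suc by (cases j) (auto simp: algebra_simps)
  qed
qed

lemma partial_deriv_partial_deriv_jet:
  assumes "open I" "smooth_on I a" "x $ ix (Suc 0) \<in> I" "i < CARD('n)" "j < CARD('n)"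
  shows "partial_deriv (ix (Suc i)) (partial_deriv (ix (Suc j)) (jet ix m a)) x =
    real ((m choose (i + j)) * ((i + j) choose i)) * jet ix (m - (i + j)) (deriv (deriv a)) x"
proof -
  let ?C = "{x. x $ ix (Suc 0) \<in> I}"
  note a' = smooth_on_deriv(1)[OF assms(1,2)]
  have "partial_deriv (ix (Suc i)) (partial_deriv (ix (Suc j)) (jet ix m a)) x =
      partial_deriv (ix (Suc i)) (\<lambda>y. real (m choose j) * jet ix (m - j) (deriv a) y) x"
    by (rule partial_deriv_cong[OF open_coordinate_cylinder[OF assms(1)]])
      (use assms partial_deriv_jet smooth_on_differentiable[OF smooth_on_partial_deriv[OF smooth_on_jet]] in auto)
  also have "\<dots> = real (m choose j) * partial_deriv (ix (Suc i)) (jet ix (m - j) (deriv a)) x"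
    by (rule partial_deriv_cmult[OF smooth_on_differentiable[OF smooth_on_jet[OF assms(1) a']]])
      (use assms in simp)
  also have "\<dots> = real ((m choose j) * ((m - j) choose i)) * jet ix (m - j - i) (deriv (deriv a)) x"
    using partial_deriv_jet[OF assms(1) a' assms(3,4)] by simp
  finally show ?thesis
    using choose_mult_shift[of m j i] binomial_symmetric[of i "i + j"] by (simp add: add.commute)
qed

end

section \<open>Diffeomorphisms and necessity\<close>

lemma frechet_derivative_nth:
  fixes g :: "'a::real_normed_vector \<Rightarrow> real ^ 'n::finite"
  assumes "g differentiable at x"
  shows "frechet_derivative (\<lambda>x. g x $ i) (at x) v = frechet_derivative g (at x) v $ i"
  using frechet_derivative_at[OF bounded_linear.has_derivative[OF bounded_linear_vec_nth
        assms[unfolded frechet_derivative_works]]]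
  by (metis)

lemma lie_deriv_cong:
  assumes "open S" "\<xi> \<in> S" "\<And>\<zeta>. \<zeta> \<in> S \<Longrightarrow> g \<zeta> = g' \<zeta>" "g differentiable at \<xi>"
  shows "lie_deriv f g \<xi> = lie_deriv f g' \<xi>"
  using partial_deriv_cong[OF assms] by (simp add: lie_deriv_def)

lemma lie_deriv_diff:
  assumes "g differentiable at \<xi>" "g' differentiable at \<xi>"
  shows "lie_deriv f (\<lambda>\<zeta>. g \<zeta> - g' \<zeta>) \<xi> = lie_deriv f g \<xi> - lie_deriv f g' \<xi>"
  using partial_deriv_diff[OF assms] by (simp add: lie_deriv_def sum_subtractf left_diff_distrib)

lemma lie_deriv_sum:
  assumes "\<And>l. l \<in> A \<Longrightarrow> g l differentiable at \<xi>"
  shows "lie_deriv f (\<lambda>\<zeta>. \<Sum>l\<in>A. g l \<zeta>) \<xi> = (\<Sum>l\<in>A. lie_deriv f (g l) \<xi>)"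
proof -
  have "lie_deriv f (\<lambda>\<zeta>. \<Sum>l\<in>A. g l \<zeta>) \<xi> = (\<Sum>i\<in>UNIV. \<Sum>l\<in>A. partial_deriv i (g l) \<xi> * f \<xi> $ i)"
    unfolding lie_deriv_def using partial_deriv_sum[of A g \<xi>, OF assms] by (simp add: sum_distrib_right)
  also have "\<dots> = (\<Sum>l\<in>A. lie_deriv f (g l) \<xi>)"
    unfolding lie_deriv_def by (rule sum.swap)
  finally show ?thesis .
qed

lemma eq_on_segment_if_directional_derivative_zero:
  fixes g :: "'a::real_normed_vector \<Rightarrow> real"
  assumes "\<And>t. t \<in> {0..1} \<Longrightarrow> g differentiable at (x + t *\<^sub>R v)"
    and "\<And>t. t \<in> {0..1} \<Longrightarrow> frechet_derivative g (at (x + t *\<^sub>R v)) v = 0"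
  shows "g (x + v) = g x"
proof -
  have "((\<lambda>t. g (x + t *\<^sub>R v)) has_derivative (\<lambda>h. 0)) (at t within {0..1})" if t: "t \<in> {0..1}" for t
  proof -
    let ?g' = "frechet_derivative g (at (x + t *\<^sub>R v))"
    have "((\<lambda>t. x + t *\<^sub>R v) has_derivative (\<lambda>h. h *\<^sub>R v)) (at t within {0..1})"
      by (auto intro!: derivative_eq_intros)
    moreover have g': "(g has_derivative ?g') (at (x + t *\<^sub>R v))"
      using assms(1)[OF t] by (simp add: frechet_derivative_works)
    ultimately have "((\<lambda>t. g (x + t *\<^sub>R v)) has_derivative (\<lambda>h. ?g' (h *\<^sub>R v))) (at t within {0..1})"
      by (rule has_derivative_compose)
    moreover have "?g' (h *\<^sub>R v) = 0" for h
      using linear_scale[OF has_derivative_linear[OF g']] assms(2)[OF t] by simp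
    ultimately show ?thesis by simp
  qed
  from has_derivative_zero_unique[OF _ this, of 1 0] show ?thesis by simp
qed

lemma diffeomorphism_on_open_image:
  assumes "diffeomorphism_on U \<Phi>" "open V" "V \<subseteq> U"
  shows "open (\<Phi> ` V)"
proof -
  obtain g where g: "open U" "open (\<Phi> ` U)" "homeomorphism U (\<Phi> ` U) \<Phi> g"
    using assms(1) unfolding diffeomorphism_on_def by blast
  have "openin (top_of_set U) V"
    using assms(2,3) by (simp add: open_subset)
  then have "openin (top_of_set (\<Phi> ` U)) (\<Phi> ` V)"
    using homeomorphism_imp_open_map[OF g(3)] by blast
  then show ?thesis using g(2) openin_open_trans by blast
qed

lemma diffeomorphism_on_subset:
  assumes "diffeomorphism_on U \<Phi>" "open V" "V \<subseteq> U"
  shows "diffeomorphism_on V \<Phi>"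
proof -
  obtain g where g: "smooth_on U \<Phi>" "homeomorphism U (\<Phi> ` U) \<Phi> g" "smooth_on (\<Phi> ` U) g"
    using assms(1) unfolding diffeomorphism_on_def by blast
  have "homeomorphism V (\<Phi> ` V) \<Phi> g"
    by (rule homeomorphism_of_subsets[OF g(2) assms(3) subset_refl refl])
  moreover have "smooth_on V \<Phi>" "smooth_on (\<Phi> ` V) g"
    using smooth_on_subset[OF g(1) assms(3)] smooth_on_subset[OF g(3) image_mono[OF assms(3)]] .
  ultimately show ?thesis
    unfolding diffeomorphism_on_def using assms(2) diffeomorphism_on_open_image[OF assms] by blast
qed

lemma diffeomorphism_on_compose:
  fixes \<Phi> :: "'a::euclidean_space \<Rightarrow> 'b::euclidean_space"
    and \<Theta> :: "'b \<Rightarrow> 'c::euclidean_space"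
  assumes "diffeomorphism_on U \<Phi>" "diffeomorphism_on (\<Phi> ` U) \<Theta>"
  shows "diffeomorphism_on U (\<lambda>x. \<Theta> (\<Phi> x))"
proof -
  obtain g where g: "open U" "open (\<Phi> ` U)" "smooth_on U \<Phi>"
    "homeomorphism U (\<Phi> ` U) \<Phi> g" "smooth_on (\<Phi> ` U) g"
    using assms(1) unfolding diffeomorphism_on_def by blast
  obtain k where k: "open (\<Theta> ` \<Phi> ` U)" "smooth_on (\<Phi> ` U) \<Theta>"
    "homeomorphism (\<Phi> ` U) (\<Theta> ` \<Phi> ` U) \<Theta> k" "smooth_on (\<Theta> ` \<Phi> ` U) k"
    using assms(2) unfolding diffeomorphism_on_def by blast
  have im: "(\<lambda>x. \<Theta> (\<Phi> x)) ` U = \<Theta> ` \<Phi> ` U" by auto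
  have "homeomorphism U (\<Theta> ` \<Phi> ` U) (\<lambda>x. \<Theta> (\<Phi> x)) (\<lambda>x. g (k x))"
    using homeomorphism_compose[OF g(4) k(3)] by (simp add: comp_def)
  moreover have "smooth_on U (\<lambda>x. \<Theta> (\<Phi> x))"
    by (rule smooth_on_compose[OF g(1,3) k(2)]) simp
  moreover have "smooth_on (\<Theta> ` \<Phi> ` U) (\<lambda>x. g (k x))"
    by (rule smooth_on_compose[OF k(1,4) g(5)]) (use k(3) in \<open>auto simp: homeomorphism_def\<close>)
  ultimately show ?thesis
    unfolding diffeomorphism_on_def im using g(1) k(1) by blast
qed

lemma diffeomorphism_onI:
  assumes "open T" "open W" "W \<subseteq> T" "smooth_on T \<phi>" "smooth_on T g"
    and "\<And>x. x \<in> T \<Longrightarrow> \<phi> x \<in> T \<and> g (\<phi> x) = x" "\<And>x. x \<in> T \<Longrightarrow> g x \<in> T \<and> \<phi> (g x) = x"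
  shows "diffeomorphism_on W \<phi>"
proof -
  have im: "\<phi> ` W = T \<inter> g -` W"
    using assms(3,6,7) by force
  have "open (\<phi> ` W)"
    unfolding im by (rule continuous_open_preimage[OF smooth_on_continuous[OF assms(5)] assms(1,2)])
  moreover have "smooth_on W \<phi>" "smooth_on (\<phi> ` W) g"
    using smooth_on_subset[OF assms(4,3)] smooth_on_subset[OF assms(5), of "\<phi> ` W"] im by auto
  moreover from this have "homeomorphism W (\<phi> ` W) \<phi> g"
    using assms(3,6,7) unfolding homeomorphism_def
    by (force intro: smooth_on_continuous)
  ultimately show ?thesis
    unfolding diffeomorphism_on_def using assms(2) by blast
qed

lemma diffeomorphism_on_derivative_eq_0:
  assumes "diffeomorphism_on U \<Phi>" "\<xi> \<in> U" "frechet_derivative \<Phi> (at \<xi>) v = 0"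
  shows "v = 0"
proof -
  obtain g where g: "open U" "smooth_on U \<Phi>" "homeomorphism U (\<Phi> ` U) \<Phi> g" "smooth_on (\<Phi> ` U) g"
    using assms(1) unfolding diffeomorphism_on_def by blast
  have d\<Phi>: "(\<Phi> has_derivative frechet_derivative \<Phi> (at \<xi>)) (at \<xi>)"
    using smooth_on_differentiable[OF g(2) assms(2)] by (simp add: frechet_derivative_works)
  have dg: "(g has_derivative frechet_derivative g (at (\<Phi> \<xi>))) (at (\<Phi> \<xi>))"
    using smooth_on_differentiable[OF g(4)] assms(2) by (simp add: frechet_derivative_works)
  have "((\<lambda>x. x) has_derivative (\<lambda>v. frechet_derivative g (at (\<Phi> \<xi>)) (frechet_derivative \<Phi> (at \<xi>) v))) (at \<xi>)"
    by (rule has_derivative_transform_within_open[OF has_derivative_compose[OF d\<Phi> dg] g(1) assms(2)])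
      (use g(3) in \<open>auto simp: homeomorphism_def\<close>)
  from has_derivative_unique[OF this has_derivative_ident]
  have "frechet_derivative g (at (\<Phi> \<xi>)) (frechet_derivative \<Phi> (at \<xi>) v) = v"
    by metis
  then show ?thesis
    using assms(3) linear_0[OF has_derivative_linear[OF dg]] by simp
qed

context coordinate_order
begin

lemma smooth_on_obs_map:
  assumes "smooth_on UNIV f" "smooth_on UNIV h"
  shows "smooth_on UNIV (obs_map ix f h)"
proof (rule smooth_on_vec[OF open_UNIV])
  fix i
  obtain j where j: "j < CARD('n)" "i = ix (Suc j)" by (rule coord_cases)
  then show "smooth_on UNIV (\<lambda>\<xi>. obs_map ix f h \<xi> $ i)"
    using smooth_on_lie_pow[OF open_UNIV assms, of j] by (simp add: eta_contract_eq)
qed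

lemma frechet_derivative_obs_map:
  assumes "smooth_on UNIV f" "smooth_on UNIV h" "j < CARD('n)"
  shows "frechet_derivative (obs_map ix f h) (at \<xi>) v $ ix (Suc j) =
    frechet_derivative (lie_pow j f h) (at \<xi>) v"
  using frechet_derivative_nth[OF smooth_on_differentiable[OF smooth_on_obs_map[OF assms(1,2)]],
      of \<xi> "ix (Suc j)" v] assms(3) by simp

lemma lie_deriv_compose_obs_map:
  assumes "smooth_on UNIV f" "smooth_on UNIV h" "u differentiable at (obs_map ix f h \<xi>)"
  shows "lie_deriv f (\<lambda>\<xi>. u (obs_map ix f h \<xi>)) \<xi> =
    (\<Sum>j<CARD('n). lie_pow (Suc j) f h \<xi> * partial_deriv (ix (Suc j)) u (obs_map ix f h \<xi>))"
proof -
  let ?\<Psi> = "obs_map ix f h"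
  have d\<Psi>: "?\<Psi> differentiable at \<xi>"
    using smooth_on_differentiable[OF smooth_on_obs_map[OF assms(1,2)]] by simp
  note D = has_derivative_compose[OF d\<Psi>[unfolded frechet_derivative_works]
      assms(3)[unfolded frechet_derivative_works]]
  have "lie_deriv f (\<lambda>\<xi>. u (?\<Psi> \<xi>)) \<xi> =
      frechet_derivative u (at (?\<Psi> \<xi>)) (frechet_derivative ?\<Psi> (at \<xi>) (f \<xi>))"
    using lie_deriv_frechet[of "\<lambda>\<xi>. u (?\<Psi> \<xi>)" \<xi> f] frechet_derivative_at[OF D] D
    by (metis differentiable_def)
  also have "\<dots> = (\<Sum>j<CARD('n). frechet_derivative ?\<Psi> (at \<xi>) (f \<xi>) $ ix (Suc j) *
      partial_deriv (ix (Suc j)) u (?\<Psi> \<xi>))"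
    by (simp add: frechet_derivative_partial[OF assms(3)] sum_coord)
  also have "\<dots> = (\<Sum>j<CARD('n). lie_pow (Suc j) f h \<xi> * partial_deriv (ix (Suc j)) u (?\<Psi> \<xi>))"
  proof (rule sum.cong[OF refl])
    fix j assume "j \<in> {..<CARD('n)}"
    then show "frechet_derivative ?\<Psi> (at \<xi>) (f \<xi>) $ ix (Suc j) * partial_deriv (ix (Suc j)) u (?\<Psi> \<xi>) =
        lie_pow (Suc j) f h \<xi> * partial_deriv (ix (Suc j)) u (?\<Psi> \<xi>)"
      using frechet_derivative_obs_map[OF assms(1,2)]
        lie_deriv_frechet[OF smooth_on_differentiable[OF smooth_on_lie_pow[OF open_UNIV assms(1,2)]], of \<xi>]
      by (simp add: lie_pow_Suc)
  qed
  finally show ?thesis .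
qed

lemma lie_deriv_jet:
  assumes "smooth_on UNIV f" "smooth_on UNIV h" "open I" "smooth_on I a" "h \<xi> \<in> I" "Suc m < CARD('n)"
  shows "lie_deriv f (\<lambda>\<xi>. jet ix m a (obs_map ix f h \<xi>)) \<xi> = jet ix (Suc m) a (obs_map ix f h \<xi>)"
proof -
  let ?x = "obs_map ix f h \<xi>"
  have I: "?x $ ix (Suc 0) \<in> I" using assms(5) by simp
  obtain k where k: "CARD('n) = Suc k" by (metis assms(6) less_imp_Suc_add)
  have "partial_deriv (ix (Suc k)) (jet ix m a) ?x = 0"
    using partial_deriv_jet[OF assms(3,4) I, of k m] assms(6) k by (simp add: binomial_eq_0)
  then show ?thesis
    using lie_deriv_compose_obs_map[OF assms(1,2) jet_differentiable[where x = ?x and ix = ix, OF assms(3,4) I]] k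
    by simp
qed

text \<open>
  \<open>ocf_shift a j\<close> is the difference between \<open>L\<^sub>f\<^sup>jh\<close> and the canonical coordinate \<open>z\<^sub>n\<^sub>-\<^sub>j\<close>
  (with \<open>z\<^sub>0 = 0\<close>), where \<open>a k\<close> is \<open>\<alpha>\<^sub>k\<^sub>+\<^sub>1\<close>.
\<close>

definition ocf_shift :: "(nat \<Rightarrow> real \<Rightarrow> real) \<Rightarrow> nat \<Rightarrow> real ^ 'n \<Rightarrow> real" where
  "ocf_shift a j x = (\<Sum>i<j. jet ix i (a (CARD('n) - j + i)) x)"

lemma smooth_on_ocf_shift:
  assumes "open I" "\<And>k. k < CARD('n) \<Longrightarrow> smooth_on I (a k)" "j \<le> CARD('n)"
  shows "smooth_on {x. x $ ix (Suc 0) \<in> I} (ocf_shift a j)"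
  unfolding ocf_shift_def[abs_def] using assms(3)
  by (intro smooth_on_sum open_coordinate_cylinder smooth_on_jet assms(1,2)) auto

lemma partial_deriv_ocf_shift:
  assumes "open I" "\<And>k. k < CARD('n) \<Longrightarrow> smooth_on I (a k)" "x $ ix (Suc 0) \<in> I"
    and "j \<le> l" "l < CARD('n)"
  shows "partial_deriv (ix (Suc l)) (ocf_shift a j) x = 0"
proof -
  have "partial_deriv (ix (Suc l)) (ocf_shift a j) x =
      (\<Sum>i<j. partial_deriv (ix (Suc l)) (jet ix i (a (CARD('n) - j + i))) x)"
    unfolding ocf_shift_def[abs_def] using assms
    by (intro partial_deriv_sum jet_differentiable[OF assms(1)]) auto
  also have "\<dots> = 0"
  proof (rule sum.neutral, rule ballI)
    fix i assume "i \<in> {..<j}"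
    then have i: "CARD('n) - j + i < CARD('n)" "i < l" using assms(4,5) by auto
    show "partial_deriv (ix (Suc l)) (jet ix i (a (CARD('n) - j + i))) x = 0"
      using partial_deriv_jet[OF assms(1) assms(2)[OF i(1)] assms(3,5)] i(2) by (simp add: binomial_eq_0)
  qed
  finally show ?thesis .
qed

lemma ocf_shift_differentiable:
  assumes "open I" "\<And>k. k < CARD('n) \<Longrightarrow> smooth_on I (a k)" "j \<le> CARD('n)" "x $ ix (Suc 0) \<in> I"
  shows "ocf_shift a j differentiable at x"
  by (rule smooth_on_differentiable[OF smooth_on_ocf_shift[where a = a, OF assms(1,2,3)]]) (use assms(4) in simp_all)

lemma has_derivative_ocf_shift_obs_map:
  assumes "smooth_on UNIV f" "smooth_on UNIV h"
    and "open I" "\<And>k. k < CARD('n) \<Longrightarrow> smooth_on I (a k)" "h \<xi> \<in> I" "j \<le> CARD('n)"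
  shows "((\<lambda>\<xi>. ocf_shift a j (obs_map ix f h \<xi>)) has_derivative
    (\<lambda>v. frechet_derivative (ocf_shift a j) (at (obs_map ix f h \<xi>))
       (frechet_derivative (obs_map ix f h) (at \<xi>) v))) (at \<xi>)"
  using smooth_on_differentiable[OF smooth_on_obs_map[OF assms(1,2)], of \<xi>]
    ocf_shift_differentiable[where a = a and x = "obs_map ix f h \<xi>", OF assms(3,4,6)] assms(5)
  by (intro has_derivative_compose[of "obs_map ix f h" _ _ _ "ocf_shift a j"])
    (simp_all add: frechet_derivative_works)

lemma lie_deriv_ocf_shift:
  assumes "smooth_on UNIV f" "smooth_on UNIV h"
    and "open I" "\<And>k. k < CARD('n) \<Longrightarrow> smooth_on I (a k)" "h \<xi> \<in> I" "j < CARD('n)"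
  shows "lie_deriv f (\<lambda>\<xi>. ocf_shift a j (obs_map ix f h \<xi>)) \<xi> =
    ocf_shift a (Suc j) (obs_map ix f h \<xi>) - a (CARD('n) - Suc j) (h \<xi>)"
proof -
  let ?\<Psi> = "obs_map ix f h"
  have d\<Psi>: "?\<Psi> differentiable at \<xi>"
    using smooth_on_differentiable[OF smooth_on_obs_map[OF assms(1,2)]] by simp
  have "lie_deriv f (\<lambda>\<xi>. ocf_shift a j (?\<Psi> \<xi>)) \<xi> =
      (\<Sum>i<j. lie_deriv f (\<lambda>\<xi>. jet ix i (a (CARD('n) - j + i)) (?\<Psi> \<xi>)) \<xi>)"
    unfolding ocf_shift_def
    by (intro lie_deriv_sum differentiable_compose[OF jet_differentiable[OF assms(3)] d\<Psi>])
      (use assms in auto)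
  also have "\<dots> = (\<Sum>i<j. jet ix (Suc i) (a (CARD('n) - Suc j + Suc i)) (?\<Psi> \<xi>))"
  proof (rule sum.cong[OF refl])
    fix i assume "i \<in> {..<j}"
    then have i: "CARD('n) - j + i < CARD('n)" "Suc i < CARD('n)"
      "CARD('n) - Suc j + Suc i = CARD('n) - j + i" using assms(6) by auto
    show "lie_deriv f (\<lambda>\<xi>. jet ix i (a (CARD('n) - j + i)) (?\<Psi> \<xi>)) \<xi> =
        jet ix (Suc i) (a (CARD('n) - Suc j + Suc i)) (?\<Psi> \<xi>)"
      unfolding i(3) by (rule lie_deriv_jet[OF assms(1-3) assms(4)[OF i(1)] assms(5) i(2)])
  qed
  also have "\<dots> = ocf_shift a (Suc j) (?\<Psi> \<xi>) - jet ix 0 (a (CARD('n) - Suc j)) (?\<Psi> \<xi>)"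
    unfolding ocf_shift_def sum.lessThan_Suc_shift by simp
  finally show ?thesis by simp
qed

lemma ocf_A_mult:
  assumes "k < CARD('n)"
  shows "(ocf_A ix *v z) $ ix (Suc k) = (case k of 0 \<Rightarrow> 0 | Suc l \<Rightarrow> z $ ix (Suc l))"
proof -
  have "(ocf_A ix *v z) $ ix (Suc k) =
      (\<Sum>l<CARD('n). (if k = Suc l then 1 else 0) * z $ ix (Suc l))"
    using assms by (simp add: ocf_A_def mat_of_def matrix_vector_mult_def sum_coord cong: sum.cong_simp)
  also have "\<dots> = (\<Sum>l<CARD('n). if k = Suc l then z $ ix (Suc l) else 0)"
    by (intro sum.cong) auto
  also have "\<dots> = (case k of 0 \<Rightarrow> 0 | Suc l \<Rightarrow> z $ ix (Suc l))"
    using assms by (auto split: nat.split)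
  finally show ?thesis .
qed

lemma ocf_C_inner: "ocf_C ix \<bullet> z = z $ ix CARD('n)"
proof -
  obtain k where k: "CARD('n) = Suc k" by (metis finite_UNIV_card_ge_0 finite gr0_implies_Suc)
  have "ocf_C ix \<bullet> z = (\<Sum>l<CARD('n). ocf_C ix $ ix (Suc l) * z $ ix (Suc l))"
    by (simp add: inner_vec_def sum_coord)
  also have "\<dots> = (\<Sum>l<CARD('n). if l = k then z $ ix (Suc l) else 0)"
    by (intro sum.cong) (auto simp: ocf_C_def k)
  finally show ?thesis by (simp add: k)
qed

lemma lie_pow_if_transforms_to_ocf:
  assumes f: "smooth_on UNIV f" and h: "smooth_on UNIV h"
    and \<Phi>: "diffeomorphism_on V \<Phi>" "transforms_to_ocf ix f h V \<Phi>"
  obtains a where "open (h ` V)" "\<And>k. k < CARD('n) \<Longrightarrow> smooth_on (h ` V) (a k)"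
    "\<And>j \<xi>. j \<le> CARD('n) \<Longrightarrow> \<xi> \<in> V \<Longrightarrow> lie_pow j f h \<xi> =
       (if j < CARD('n) then \<Phi> \<xi> $ ix (CARD('n) - j) else 0) + ocf_shift a j (obs_map ix f h \<xi>)"
proof -
  let ?n = "CARD('n)" and ?\<Psi> = "obs_map ix f h"
  obtain \<alpha> where \<alpha>: "\<forall>k\<in>{1..?n}. smooth_on (h ` V) (\<alpha> k)"
    and ode: "\<And>\<xi>. \<xi> \<in> V \<Longrightarrow> frechet_derivative \<Phi> (at \<xi>) (f \<xi>) =
      ocf_A ix *v \<Phi> \<xi> + vec_of ix (\<lambda>k. \<alpha> k (h \<xi>))"
    and out: "\<And>\<xi>. \<xi> \<in> V \<Longrightarrow> h \<xi> = \<Phi> \<xi> $ ix ?n"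
    using \<Phi>(2) unfolding transforms_to_ocf_def ocf_C_inner by blast
  define a where "a k = \<alpha> (Suc k)" for k
  have a: "smooth_on (h ` V) (a k)" if "k < ?n" for k
    using \<alpha> that by (simp add: a_def)
  have V: "open V" "open (\<Phi> ` V)" "smooth_on V \<Phi>"
    using \<Phi>(1) by (auto simp: diffeomorphism_on_def)
  have "h ` V = (\<lambda>z. z $ ix ?n) ` \<Phi> ` V"
    using out by (auto simp: image_image)
  then have I: "open (h ` V)"
    using open_image_vec_nth[OF V(2)] by simp
  have "lie_pow j f h \<xi> = (if j < ?n then \<Phi> \<xi> $ ix (?n - j) else 0) + ocf_shift a j (?\<Psi> \<xi>)"
    if "j \<le> ?n" "\<xi> \<in> V" for j \<xi>
    using that
  proof (induction j arbitrary: \<xi>)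
    case 0
    then show ?case using out by (simp add: ocf_shift_def)
  next
    case (Suc j)
    define k where "k = ?n - Suc j"
    have k: "?n - j = Suc k" "k < ?n" using Suc.prems by (auto simp: k_def)
    have \<Phi>\<xi>: "\<Phi> differentiable at \<xi>"
      using smooth_on_differentiable[OF V(3) Suc.prems(2)] .
    have h\<xi>: "h \<xi> \<in> h ` V" using Suc.prems(2) by simp
    have j: "j < ?n" using Suc.prems(1) by simp
    have d: "(\<lambda>\<xi>. ocf_shift a j (?\<Psi> \<xi>)) differentiable at \<xi>"
      using has_derivative_ocf_shift_obs_map[where a = a and f = f and h = h and I = "h ` V", OF f h I a h\<xi> less_imp_le[OF j]] unfolding differentiable_def by auto
    have dl: "lie_pow j f h differentiable at \<xi>"
      using smooth_on_differentiable[OF smooth_on_lie_pow[OF open_UNIV f h]] by simp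
    have "lie_deriv f (\<lambda>\<xi>. lie_pow j f h \<xi> - ocf_shift a j (?\<Psi> \<xi>)) \<xi> = lie_deriv f (\<lambda>\<xi>. \<Phi> \<xi> $ ix (Suc k)) \<xi>"
      by (rule lie_deriv_cong[OF V(1) Suc.prems(2) _ differentiable_diff[OF dl d]])
        (use Suc.IH j k in simp)
    also have "\<dots> = frechet_derivative \<Phi> (at \<xi>) (f \<xi>) $ ix (Suc k)"
      using \<Phi>\<xi> differentiable_compose[OF bounded_linear_imp_differentiable[OF bounded_linear_vec_nth] \<Phi>\<xi>]
      by (simp add: lie_deriv_frechet frechet_derivative_nth)
    also have "\<dots> = (if Suc j < ?n then \<Phi> \<xi> $ ix (?n - Suc j) else 0) + a k (h \<xi>)"
      using ode[OF Suc.prems(2)] ocf_A_mult[OF k(2)] k Suc.prems(1)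
      by (auto simp: a_def k_def split: nat.split)
    finally show ?case
      using lie_deriv_diff[OF dl d] lie_deriv_ocf_shift[where a = a and f = f and h = h and I = "h ` V", OF f h I a h\<xi> j]
      by (simp add: lie_pow_Suc k_def)
  qed
  then show ?thesis using that I a by blast
qed

lemma rank_codistribution_matrixI:
  assumes "smooth_on UNIV f" "smooth_on UNIV h"
    and "\<And>v. frechet_derivative (obs_map ix f h) (at \<xi>) v = 0 \<Longrightarrow> v = 0"
  shows "rank (codistribution_matrix ix f h \<xi>) = CARD('n)"
proof -
  have mult: "codistribution_matrix ix f h \<xi> *v v = frechet_derivative (obs_map ix f h) (at \<xi>) v" for v
  proof (rule vec_coord_eqI)
    fix j assume j: "j < CARD('n)"
    have "(codistribution_matrix ix f h \<xi> *v v) $ ix (Suc j) =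
        (\<Sum>l<CARD('n). partial_deriv (ix (Suc l)) (lie_pow j f h) \<xi> * v $ ix (Suc l))"
      using j by (simp add: codistribution_matrix_def mat_of_def matrix_vector_mult_def sum_coord cong: sum.cong_simp)
    then show "(codistribution_matrix ix f h \<xi> *v v) $ ix (Suc j) =
        frechet_derivative (obs_map ix f h) (at \<xi>) v $ ix (Suc j)"
      using frechet_derivative_partial[OF smooth_on_differentiable[OF
            smooth_on_lie_pow[OF open_UNIV assms(1,2)]], of \<xi> j v]
      by (simp add: frechet_derivative_obs_map[OF assms(1,2) j] sum_coord mult.commute)
  qed
  have "inj ((*v) (codistribution_matrix ix f h \<xi>))"
    using assms(3) by (subst linear_injective_0) (simp_all add: mult)
  then show ?thesis by (simp add: full_rank_injective)
qed

lemma codistribution_full_on_if_transforms_to_ocf: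
  assumes f: "smooth_on UNIV f" and h: "smooth_on UNIV h"
    and \<Phi>: "diffeomorphism_on V \<Phi>" "transforms_to_ocf ix f h V \<Phi>"
  shows "codistribution_full_on ix f h V"
  unfolding codistribution_full_on_def
proof (intro ballI rank_codistribution_matrixI[OF f h])
  fix \<xi> v assume \<xi>: "\<xi> \<in> V" and v: "frechet_derivative (obs_map ix f h) (at \<xi>) v = 0"
  let ?n = "CARD('n)" and ?\<Psi> = "obs_map ix f h"
  obtain a where I: "open (h ` V)" and a: "\<And>k. k < ?n \<Longrightarrow> smooth_on (h ` V) (a k)"
    and lie: "\<And>j \<xi>. j \<le> ?n \<Longrightarrow> \<xi> \<in> V \<Longrightarrow> lie_pow j f h \<xi> =
       (if j < ?n then \<Phi> \<xi> $ ix (?n - j) else 0) + ocf_shift a j (?\<Psi> \<xi>)"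
    using lie_pow_if_transforms_to_ocf[OF assms] by blast
  have V: "open V" "smooth_on V \<Phi>"
    using \<Phi>(1) by (auto simp: diffeomorphism_on_def)
  have h\<xi>: "h \<xi> \<in> h ` V" using \<xi> by simp
  have "frechet_derivative \<Phi> (at \<xi>) v = 0"
  proof (rule vec_coord_eqI)
    fix k assume k: "k < ?n"
    define j where "j = ?n - Suc k"
    have j: "j < ?n" "?n - j = Suc k" using k by (auto simp: j_def)
    have dl: "(lie_pow j f h has_derivative frechet_derivative (lie_pow j f h) (at \<xi>)) (at \<xi>)"
      using smooth_on_differentiable[OF smooth_on_lie_pow[OF open_UNIV f h]]
      by (simp add: frechet_derivative_works)
    note ds = has_derivative_ocf_shift_obs_map[where a = a and f = f and h = h and I = "h ` V", OF f h I a h\<xi> less_imp_le[OF j(1)]]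
    have "((\<lambda>\<xi>. \<Phi> \<xi> $ ix (Suc k)) has_derivative
      (\<lambda>v. frechet_derivative (lie_pow j f h) (at \<xi>) v - frechet_derivative (ocf_shift a j) (at (?\<Psi> \<xi>))
         (frechet_derivative ?\<Psi> (at \<xi>) v))) (at \<xi>)"
    proof (rule has_derivative_transform_within_open[OF has_derivative_diff[OF dl ds] V(1) \<xi>])
      fix \<zeta> assume "\<zeta> \<in> V"
      then show "lie_pow j f h \<zeta> - ocf_shift a j (?\<Psi> \<zeta>) = \<Phi> \<zeta> $ ix (Suc k)"
        using lie[OF less_imp_le[OF j(1)]] j by simp
    qed
    from fun_cong[OF frechet_derivative_at[OF this, symmetric], of v]
    have "frechet_derivative (\<lambda>\<xi>. \<Phi> \<xi> $ ix (Suc k)) (at \<xi>) v =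
        frechet_derivative (lie_pow j f h) (at \<xi>) v - frechet_derivative (ocf_shift a j) (at (?\<Psi> \<xi>)) 0"
      unfolding v .
    moreover have "frechet_derivative (lie_pow j f h) (at \<xi>) v = 0"
      using frechet_derivative_obs_map[OF f h j(1), of \<xi> v] v by simp
    moreover have "frechet_derivative (ocf_shift a j) (at (?\<Psi> \<xi>)) 0 = 0"
      using linear_0[OF linear_frechet_derivative[OF ocf_shift_differentiable[where a = a, OF I a, of j]]] j h\<xi> by simp
    ultimately show "frechet_derivative \<Phi> (at \<xi>) v $ ix (Suc k) = 0 $ ix (Suc k)"
      using frechet_derivative_nth[OF smooth_on_differentiable[OF V(2) \<xi>], of "ix (Suc k)" v] by simp
  qed
  then show "v = 0"
    using diffeomorphism_on_derivative_eq_0[OF \<Phi>(1) \<xi>] by simp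
qed

end

section \<open>The Pascal-Hessian condition and its integration\<close>

lemma partial_deriv2_cong:
  assumes "open S" "x \<in> S" "\<And>y. y \<in> S \<Longrightarrow> g y = g' y" "smooth_on S g"
  shows "partial_deriv i (partial_deriv j g) x = partial_deriv i (partial_deriv j g') x"
  using partial_deriv_cong[OF assms(1) _ assms(3) smooth_on_differentiable[OF assms(4)]]
  by (intro partial_deriv_cong[OF assms(1,2)]
      smooth_on_differentiable[OF smooth_on_partial_deriv[OF assms(4)] assms(2)])

lemma partial_deriv2_diff:
  assumes "open S" "x \<in> S" "smooth_on S g" "smooth_on S g'"
  shows "partial_deriv i (partial_deriv j (\<lambda>x. g x - g' x)) x =
    partial_deriv i (partial_deriv j g) x - partial_deriv i (partial_deriv j g') x"
proof -
  have "partial_deriv i (partial_deriv j (\<lambda>x. g x - g' x)) x =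
      partial_deriv i (\<lambda>x. partial_deriv j g x - partial_deriv j g' x) x"
    using assms
    by (intro partial_deriv_cong[OF assms(1,2)] partial_deriv_diff
        smooth_on_differentiable[OF smooth_on_partial_deriv[OF smooth_on_diff[OF assms(1,3,4)]]])
      (auto intro: smooth_on_differentiable)
  also have "\<dots> = partial_deriv i (partial_deriv j g) x - partial_deriv i (partial_deriv j g') x"
    by (intro partial_deriv_diff smooth_on_differentiable[OF smooth_on_partial_deriv[OF assms(3)] assms(2)]
        smooth_on_differentiable[OF smooth_on_partial_deriv[OF assms(4)] assms(2)])
  finally show ?thesis .
qed

lemma partial_deriv2_sum:
  assumes "open S" "x \<in> S" "\<And>l. l \<in> A \<Longrightarrow> smooth_on S (g l)"
  shows "partial_deriv i (partial_deriv j (\<lambda>x. \<Sum>l\<in>A. g l x)) x =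
    (\<Sum>l\<in>A. partial_deriv i (partial_deriv j (g l)) x)"
proof -
  have "partial_deriv i (partial_deriv j (\<lambda>x. \<Sum>l\<in>A. g l x)) x =
      partial_deriv i (\<lambda>x. \<Sum>l\<in>A. partial_deriv j (g l) x) x"
  proof (rule partial_deriv_cong[OF assms(1,2)])
    show "partial_deriv j (\<lambda>x. \<Sum>l\<in>A. g l x) y = (\<Sum>l\<in>A. partial_deriv j (g l) y)" if "y \<in> S" for y
      by (rule partial_deriv_sum) (rule smooth_on_differentiable[OF assms(3) that])
    show "partial_deriv j (\<lambda>x. \<Sum>l\<in>A. g l x) differentiable at x"
      by (rule smooth_on_differentiable[OF smooth_on_partial_deriv[OF smooth_on_sum[OF assms(1,3)]] assms(2)])
  qed
  also have "\<dots> = (\<Sum>l\<in>A. partial_deriv i (partial_deriv j (g l)) x)"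
    by (rule partial_deriv_sum) (rule smooth_on_differentiable[OF smooth_on_partial_deriv[OF assms(3)] assms(2)])
  finally show ?thesis .
qed

context coordinate_order
begin

definition pascal_at :: "(real ^ 'n \<Rightarrow> real) \<Rightarrow> real ^ 'n \<Rightarrow> bool" where
  "pascal_at p x \<longleftrightarrow> (\<forall>i<CARD('n). \<forall>j<CARD('n).
     partial_deriv (ix (Suc i)) (partial_deriv (ix (Suc j)) p) x =
       (if i + j < CARD('n)
        then real ((i + j) choose i) *
          partial_deriv (ix (Suc 0)) (partial_deriv (ix (Suc (i + j))) p) x
        else 0))"

lemma pascal_hessian_on_iff: "pascal_hessian_on ix S p \<longleftrightarrow> (\<forall>x\<in>S. pascal_at p x)"
proof -
  have ball: "(\<forall>i\<in>{1..CARD('n)}. P i) \<longleftrightarrow> (\<forall>i<CARD('n). P (Suc i))" for P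
    unfolding image_Suc_lessThan[symmetric] by auto
  show ?thesis
    unfolding pascal_hessian_on_def pascal_at_def ball by (simp add: Suc_le_eq numeral_2_eq_2)
qed

lemma pascal_at_cong:
  assumes "open S" "x \<in> S" "\<And>y. y \<in> S \<Longrightarrow> p y = q y" "smooth_on S p" "pascal_at p x"
  shows "pascal_at q x"
proof -
  have "partial_deriv i (partial_deriv j q) x = partial_deriv i (partial_deriv j p) x" for i j
    by (rule partial_deriv2_cong[symmetric, OF assms(1-4)])
  then show ?thesis using assms(5) by (simp only: pascal_at_def)
qed

lemma pascal_at_diff:
  assumes "open S" "x \<in> S" "smooth_on S p" "smooth_on S q" "pascal_at p x" "pascal_at q x"
  shows "pascal_at (\<lambda>x. p x - q x) x"
  unfolding pascal_at_def partial_deriv2_diff[OF assms(1-4)]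
proof (intro allI impI)
  fix i j assume ij: "i < CARD('n)" "j < CARD('n)"
  let ?d = "\<lambda>p. partial_deriv (ix (Suc 0)) (partial_deriv (ix (Suc (i + j))) p) x"
  show "partial_deriv (ix (Suc i)) (partial_deriv (ix (Suc j)) p) x -
      partial_deriv (ix (Suc i)) (partial_deriv (ix (Suc j)) q) x =
      (if i + j < CARD('n) then real ((i + j) choose i) * (?d p - ?d q) else 0)"
    using assms(5)[unfolded pascal_at_def, rule_format, OF ij]
      assms(6)[unfolded pascal_at_def, rule_format, OF ij]
    by (simp only: right_diff_distrib split: if_split) simp
qed

lemma pascal_at_sum:
  assumes "open S" "x \<in> S" "\<And>l. l \<in> A \<Longrightarrow> smooth_on S (p l)" "\<And>l. l \<in> A \<Longrightarrow> pascal_at (p l) x"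
  shows "pascal_at (\<lambda>x. \<Sum>l\<in>A. p l x) x"
  unfolding pascal_at_def
proof (intro allI impI)
  fix i j assume ij: "i < CARD('n)" "j < CARD('n)"
  let ?d = "\<lambda>p. partial_deriv (ix (Suc 0)) (partial_deriv (ix (Suc (i + j))) p) x"
  have sum: "partial_deriv i (partial_deriv j (\<lambda>x. \<Sum>l\<in>A. p l x)) x =
      (\<Sum>l\<in>A. partial_deriv i (partial_deriv j (p l)) x)" for i j
    by (rule partial_deriv2_sum[OF assms(1,2)]) (rule assms(3))
  have "partial_deriv (ix (Suc i)) (partial_deriv (ix (Suc j)) (\<lambda>x. \<Sum>l\<in>A. p l x)) x =
      (\<Sum>l\<in>A. if i + j < CARD('n) then real ((i + j) choose i) * ?d (p l) else 0)"
    unfolding sum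
    by (rule sum.cong[OF refl]) (rule assms(4)[unfolded pascal_at_def, rule_format, OF _ ij])
  also have "\<dots> = (if i + j < CARD('n) then real ((i + j) choose i) * ?d (\<lambda>x. \<Sum>l\<in>A. p l x) else 0)"
    unfolding sum by (simp add: sum_distrib_left)
  finally show "partial_deriv (ix (Suc i)) (partial_deriv (ix (Suc j)) (\<lambda>x. \<Sum>l\<in>A. p l x)) x =
      (if i + j < CARD('n) then real ((i + j) choose i) * ?d (\<lambda>x. \<Sum>l\<in>A. p l x) else 0)" .
qed

lemma pascal_at_jet:
  assumes "open I" "smooth_on I a" "x $ ix (Suc 0) \<in> I" "m < CARD('n)"
  shows "pascal_at (jet ix m a) x"
  using partial_deriv_partial_deriv_jet[OF assms(1-3)] assms(4)
  by (auto simp: pascal_at_def binomial_eq_0)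

lemma obs_p_obs_map:
  assumes "inj_on (obs_map ix f h) U" "\<xi> \<in> U"
  shows "obs_p ix f h U (obs_map ix f h \<xi>) = lie_pow CARD('n) f h \<xi>"
  using assms by (simp add: obs_p_def)

lemma inj_on_diffeomorphism: "diffeomorphism_on U \<Phi> \<Longrightarrow> inj_on \<Phi> U"
  unfolding diffeomorphism_on_def homeomorphism_def by (metis inj_on_inverseI)

lemma smooth_on_obs_p:
  assumes f: "smooth_on UNIV f" and h: "smooth_on UNIV h"
    and \<Psi>: "diffeomorphism_on V (obs_map ix f h)"
  shows "smooth_on (obs_map ix f h ` V) (obs_p ix f h V)"
proof -
  let ?\<Psi> = "obs_map ix f h"
  obtain g where g: "open (?\<Psi> ` V)" "homeomorphism V (?\<Psi> ` V) ?\<Psi> g" "smooth_on (?\<Psi> ` V) g"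
    using \<Psi> unfolding diffeomorphism_on_def by blast
  have "smooth_on (?\<Psi> ` V) (\<lambda>x. lie_pow CARD('n) f h (g x))"
    by (rule smooth_on_compose[OF g(1,3) smooth_on_lie_pow[OF open_UNIV f h]]) simp
  then show ?thesis
  proof (rule smooth_on_cong[OF g(1), rotated])
    fix x assume "x \<in> ?\<Psi> ` V"
    then show "lie_pow CARD('n) f h (g x) = obs_p ix f h V x"
      using g(2) obs_p_obs_map[OF inj_on_diffeomorphism[OF \<Psi>]] by (auto simp: homeomorphism_def)
  qed
qed

lemma pascal_hessian_on_if_transforms_to_ocf:
  assumes f: "smooth_on UNIV f" and h: "smooth_on UNIV h"
    and \<Phi>: "diffeomorphism_on V \<Phi>" "transforms_to_ocf ix f h V \<Phi>"
    and \<Psi>: "diffeomorphism_on U (obs_map ix f h)" "open V" "V \<subseteq> U"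
  shows "pascal_hessian_on ix (obs_map ix f h ` V) (obs_p ix f h U)"
  unfolding pascal_hessian_on_iff
proof
  let ?n = "CARD('n)" and ?\<Psi> = "obs_map ix f h"
  obtain a where I: "open (h ` V)" and a: "\<And>k. k < ?n \<Longrightarrow> smooth_on (h ` V) (a k)"
    and lie: "\<And>j \<xi>. j \<le> ?n \<Longrightarrow> \<xi> \<in> V \<Longrightarrow> lie_pow j f h \<xi> =
       (if j < ?n then \<Phi> \<xi> $ ix (?n - j) else 0) + ocf_shift a j (?\<Psi> \<xi>)"
    using lie_pow_if_transforms_to_ocf[OF f h \<Phi>] by blast
  have W: "open (?\<Psi> ` V)" by (rule diffeomorphism_on_open_image[OF \<Psi>])
  have cyl: "?\<Psi> ` V \<subseteq> {x. x $ ix (Suc 0) \<in> h ` V}" by auto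
  have jet: "smooth_on (?\<Psi> ` V) (jet ix i (a i))" if "i < ?n" for i
    by (rule smooth_on_subset[OF smooth_on_jet[where ix = ix, OF I a[OF that]] cyl])
  fix x assume x: "x \<in> ?\<Psi> ` V"
  show "pascal_at (obs_p ix f h U) x"
  proof (rule pascal_at_cong[OF W x])
    show "pascal_at (\<lambda>x. \<Sum>i<?n. jet ix i (a i) x) x"
    proof (rule pascal_at_sum[OF W x])
      fix i assume "i \<in> {..<?n}"
      then have i: "i < ?n" by simp
      show "smooth_on (?\<Psi> ` V) (jet ix i (a i))" by (rule jet[OF i])
      show "pascal_at (jet ix i (a i)) x" by (rule pascal_at_jet[OF I a[OF i] _ i]) (use x cyl in blast)
    qed
    show "smooth_on (?\<Psi> ` V) (\<lambda>x. \<Sum>i<?n. jet ix i (a i) x)"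
      by (rule smooth_on_sum[OF W]) (use jet in simp)
    fix y assume "y \<in> ?\<Psi> ` V"
    then obtain \<xi> where \<xi>: "\<xi> \<in> V" "y = ?\<Psi> \<xi>" by blast
    then have "obs_p ix f h U y = lie_pow ?n f h \<xi>"
      using obs_p_obs_map[OF inj_on_diffeomorphism[OF \<Psi>(1)]] \<Psi>(3) by blast
    then show "(\<Sum>i<?n. jet ix i (a i) y) = obs_p ix f h U y"
      using lie[OF order_refl \<xi>(1)] \<xi>(2) by (simp add: ocf_shift_def)
  qed
qed

lemma frechet_derivative_eq_0_if_partials_eq_0:
  fixes g :: "real ^ 'n \<Rightarrow> real"
  assumes "g differentiable at x"
    and "\<And>j. j < CARD('n) \<Longrightarrow> v $ ix (Suc j) = 0 \<or> partial_deriv (ix (Suc j)) g x = 0"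
  shows "frechet_derivative g (at x) v = 0"
  unfolding frechet_derivative_partial[OF assms(1)] sum_coord
  by (rule sum.neutral) (use assms(2) in auto)

lemma function_of_first_coordinate:
  fixes q :: "real ^ 'n \<Rightarrow> real"
  assumes W: "open W" and slices: "\<And>c. connected {x \<in> W. x $ ix (Suc 0) = c}" and q: "smooth_on W q"
    and zero: "\<And>x j. x \<in> W \<Longrightarrow> 0 < j \<Longrightarrow> j < CARD('n) \<Longrightarrow> partial_deriv (ix (Suc j)) q x = 0"
  obtains b where "smooth_on ((\<lambda>x. x $ ix (Suc 0)) ` W) b" "\<And>x. x \<in> W \<Longrightarrow> q x = b (x $ ix (Suc 0))"
proof -
  have "q constant_on {x \<in> W. x $ ix (Suc 0) = c}" for c
  proof (rule locally_constant_imp_constant[OF slices])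
    let ?S = "{x \<in> W. x $ ix (Suc 0) = c}"
    fix x assume x: "x \<in> ?S"
    then obtain e where e: "e > 0" "ball x e \<subseteq> W"
      using W open_contains_ball by blast
    have "q y = q x" if y: "y \<in> W" "y $ ix (Suc 0) = c" "y \<in> ball x e" for y
    proof -
      have seg: "x + t *\<^sub>R (y - x) \<in> W" if "t \<in> {0..1}" for t
      proof -
        have "x + t *\<^sub>R (y - x) = (1 - t) *\<^sub>R x + t *\<^sub>R y" by (simp add: algebra_simps)
        then have "x + t *\<^sub>R (y - x) \<in> ball x e"
          using convexD_alt[OF convex_ball, of x x e y t] y(3) e(1) that by simp
        then show ?thesis using e(2) by blast
      qed
      have "q (x + (y - x)) = q x"
      proof (rule eq_on_segment_if_directional_derivative_zero)
        fix t :: real assume t: "t \<in> {0..1}"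
        show d: "q differentiable at (x + t *\<^sub>R (y - x))"
          by (rule smooth_on_differentiable[OF q seg[OF t]])
        show "frechet_derivative q (at (x + t *\<^sub>R (y - x))) (y - x) = 0"
        proof (rule frechet_derivative_eq_0_if_partials_eq_0[OF d])
          fix j assume "j < CARD('n)"
          then show "(y - x) $ ix (Suc j) = 0 \<or> partial_deriv (ix (Suc j)) q (x + t *\<^sub>R (y - x)) = 0"
            using zero[OF seg[OF t]] x y(2) by (cases j) auto
        qed
      qed
      then show ?thesis by simp
    qed
    then have "\<forall>y \<in> ?S \<inter> ball x e. q y = q x" by blast
    moreover have "openin (top_of_set ?S) (?S \<inter> ball x e)"
      by (simp add: openin_open_Int)
    moreover have "x \<in> ?S \<inter> ball x e" using x e(1) by simp
    ultimately show "\<exists>T. openin (top_of_set ?S) T \<and> x \<in> T \<and> (\<forall>y\<in>T. q y = q x)"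
      by blast
  qed
  then have "\<exists>b. \<forall>x\<in>W. x $ ix (Suc 0) = c \<longrightarrow> q x = b" for c
    unfolding constant_on_def by (metis (mono_tags, lifting) mem_Collect_eq)
  then obtain b where b: "\<And>x. x \<in> W \<Longrightarrow> q x = b (x $ ix (Suc 0))"
    by metis
  have "smooth_on ((\<lambda>x. x $ ix (Suc 0)) ` W) b"
  proof (rule smooth_on_locally)
    fix c assume "c \<in> (\<lambda>x. x $ ix (Suc 0)) ` W"
    then obtain x where x: "x \<in> W" "c = x $ ix (Suc 0)" by blast
    define \<gamma> where "\<gamma> t = x + (t - c) *\<^sub>R axis (ix (Suc 0)) 1" for t
    define N where "N = \<gamma> -` W"
    have s\<gamma>: "smooth_on UNIV \<gamma>"
      unfolding \<gamma>_def[abs_def]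
      by (intro smooth_on_add smooth_on_scaleR smooth_on_const smooth_on_diff smooth_on_ident open_UNIV)
    have N: "open N"
      unfolding N_def using open_vimage[OF W smooth_on_continuous[OF s\<gamma>]] .
    have "smooth_on N (\<lambda>t. q (\<gamma> t))"
      by (rule smooth_on_compose[OF N smooth_on_subset[OF s\<gamma>] q]) (auto simp: N_def)
    then have "smooth_on N b"
    proof (rule smooth_on_cong[OF N, rotated])
      fix t assume "t \<in> N"
      then show "q (\<gamma> t) = b t"
        using b[of "\<gamma> t"] x(2) by (simp add: N_def \<gamma>_def axis_def)
    qed
    moreover have "c \<in> N" using x(1) by (simp add: N_def \<gamma>_def)
    ultimately show "\<exists>T. open T \<and> c \<in> T \<and> smooth_on T b" using N by blast
  qed
  then show ?thesis using that b by blast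
qed

lemma sum_of_jets_if_pascal:
  fixes q :: "real ^ 'n \<Rightarrow> real"
  assumes W: "open W" "connected W" and slices: "\<And>c. connected {x \<in> W. x $ ix (Suc 0) = c}"
    and q: "smooth_on W q" "\<And>x. x \<in> W \<Longrightarrow> pascal_at q x" and k: "k < CARD('n)"
    and zero: "\<And>x j. x \<in> W \<Longrightarrow> k < j \<Longrightarrow> j < CARD('n) \<Longrightarrow> partial_deriv (ix (Suc j)) q x = 0"
  shows "\<exists>a. (\<forall>i\<le>k. smooth_on ((\<lambda>x. x $ ix (Suc 0)) ` W) (a i)) \<and>
    (\<forall>x\<in>W. q x = (\<Sum>i\<le>k. jet ix i (a i) x))"
  using q k zero
proof (induction k arbitrary: q)
  case 0
  obtain b where "smooth_on ((\<lambda>x. x $ ix (Suc 0)) ` W) b" "\<And>x. x \<in> W \<Longrightarrow> q x = b (x $ ix (Suc 0))"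
    using function_of_first_coordinate[OF W(1) slices 0(1,4)] by blast
  then show ?case by (intro exI[of _ "\<lambda>_. b"]) simp
next
  case (Suc k)
  let ?I = "(\<lambda>x. x $ ix (Suc 0)) ` W"
  have I: "open ?I" "connected ?I"
    using open_image_vec_nth[OF W(1)] connected_continuous_image[OF _ W(2), of "\<lambda>x. x $ ix (Suc 0)"]
      smooth_on_continuous[OF smooth_on_nth[OF W(1)]] by simp_all
  have cyl: "W \<subseteq> {x. x $ ix (Suc 0) \<in> ?I}" by auto
  let ?dq = "partial_deriv (ix (Suc (Suc k))) q"
  have "partial_deriv (ix (Suc l)) ?dq x = 0" if x: "x \<in> W" and l: "0 < l" "l < CARD('n)" for x l
  proof (cases "l + Suc k < CARD('n)")
    case True
    have "partial_deriv (ix (Suc 0)) (partial_deriv (ix (Suc (l + Suc k))) q) x =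
        partial_deriv (ix (Suc 0)) (\<lambda>x. 0) x"
      by (rule partial_deriv_cong[OF W(1) x])
        (use True l Suc.prems(4) smooth_on_differentiable[OF smooth_on_partial_deriv[OF Suc.prems(1)] x] in auto)
    with Suc.prems(2)[OF x, unfolded pascal_at_def, rule_format, OF l(2) Suc.prems(3)] show ?thesis
      using True by simp
  next
    case False
    with Suc.prems(2)[OF x, unfolded pascal_at_def, rule_format, OF l(2) Suc.prems(3)] show ?thesis
      by simp
  qed
  then obtain b where b: "smooth_on ?I b" "\<And>x. x \<in> W \<Longrightarrow> ?dq x = b (x $ ix (Suc 0))"
    using function_of_first_coordinate[OF W(1) slices smooth_on_partial_deriv[OF Suc.prems(1)]] by blast
  obtain c where c: "smooth_on ?I c" "\<And>t. t \<in> ?I \<Longrightarrow> (c has_real_derivative b t) (at t)"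
    using smooth_antiderivative[OF I b(1)] by blast
  let ?J = "jet ix (Suc k) c"
  have J: "smooth_on W ?J"
    by (rule smooth_on_subset[OF smooth_on_jet[where ix = ix, OF I(1) c(1)] cyl])
  have "\<exists>a. (\<forall>i\<le>k. smooth_on ?I (a i)) \<and> (\<forall>x\<in>W. q x - ?J x = (\<Sum>i\<le>k. jet ix i (a i) x))"
  proof (rule Suc.IH)
    show "smooth_on W (\<lambda>x. q x - ?J x)"
      by (rule smooth_on_diff[OF W(1) Suc.prems(1) J])
    show "pascal_at (\<lambda>x. q x - ?J x) x" if "x \<in> W" for x
      by (rule pascal_at_diff[OF W(1) that Suc.prems(1) J Suc.prems(2)[OF that]
            pascal_at_jet[OF I(1) c(1) _ Suc.prems(3)]]) (use that in blast)
    show "k < CARD('n)" using Suc.prems(3) by simp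
    fix x j assume x: "x \<in> W" and j: "k < j" "j < CARD('n)"
    have xI: "x $ ix (Suc 0) \<in> ?I" using x by blast
    have *: "partial_deriv (ix (Suc j)) (\<lambda>x. q x - ?J x) x = partial_deriv (ix (Suc j)) q x -
        real (Suc k choose j) * jet ix (Suc k - j) (deriv c) x"
      using partial_deriv_diff[OF smooth_on_differentiable[OF Suc.prems(1) x] smooth_on_differentiable[OF J x]]
        partial_deriv_jet[OF I(1) c(1) xI j(2)] by (simp del: jet.simps)
    show "partial_deriv (ix (Suc j)) (\<lambda>x. q x - ?J x) x = 0"
    proof (cases "j = Suc k")
      case True
      then show ?thesis
        using * b(2)[OF x] DERIV_imp_deriv[OF c(2)[OF xI]] by simp
    next
      case False
      then show ?thesis
        using * Suc.prems(4)[OF x _ j(2)] j(1) by (simp add: binomial_eq_0)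
    qed
  qed
  then obtain a where a: "\<forall>i\<le>k. smooth_on ?I (a i)" "\<forall>x\<in>W. q x - ?J x = (\<Sum>i\<le>k. jet ix i (a i) x)"
    by blast
  show ?case
  proof (intro exI[of _ "a(Suc k := c)"] conjI)
    show "\<forall>i\<le>Suc k. smooth_on ?I ((a(Suc k := c)) i)"
      using a(1) c(1) by (simp add: le_Suc_eq)
    show "\<forall>x\<in>W. q x = (\<Sum>i\<le>Suc k. jet ix i ((a(Suc k := c)) i) x)"
      using a(2) by (simp del: jet.simps cong: sum.cong_simp) (metis add.commute diff_add_cancel)
  qed
qed

end

section \<open>The transformation to observer canonical form\<close>

lemma diffeomorphism_on_cong:
  assumes "\<And>x. x \<in> U \<Longrightarrow> \<Phi> x = \<Phi>' x" "diffeomorphism_on U \<Phi>"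
  shows "diffeomorphism_on U \<Phi>'"
proof -
  obtain g where g: "open U" "open (\<Phi> ` U)" "smooth_on U \<Phi>"
    "homeomorphism U (\<Phi> ` U) \<Phi> g" "smooth_on (\<Phi> ` U) g"
    using assms(2) unfolding diffeomorphism_on_def by blast
  have im: "\<Phi>' ` U = \<Phi> ` U" using assms(1) by (simp cong: image_cong)
  have "homeomorphism U (\<Phi> ` U) \<Phi>' g"
    by (rule homeomorphism_cong[OF g(4) refl refl]) (simp_all add: assms(1))
  moreover have "smooth_on U \<Phi>'" by (rule smooth_on_cong[OF g(1) assms(1) g(3)])
  ultimately show ?thesis
    unfolding diffeomorphism_on_def im using g by blast
qed

context coordinate_order
begin

lemma ocf_shift_add:
  assumes I: "open I" "\<And>k. k < CARD('n) \<Longrightarrow> smooth_on I (a k)"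
    and j: "j < CARD('n)" and x: "x $ ix (Suc 0) \<in> I"
    and v: "\<And>l. l < j \<Longrightarrow> v $ ix (Suc l) = 0"
  shows "ocf_shift a j (x + v) = ocf_shift a j x"
proof (cases j)
  case 0
  then show ?thesis by (simp add: ocf_shift_def)
next
  case (Suc j')
  show ?thesis
  proof (rule eq_on_segment_if_directional_derivative_zero)
    fix t :: real
    have I': "(x + t *\<^sub>R v) $ ix (Suc 0) \<in> I" using x v Suc by simp
    show d: "ocf_shift a j differentiable at (x + t *\<^sub>R v)"
      by (rule ocf_shift_differentiable[where a = a, OF I less_imp_le[OF j] I'])
    show "frechet_derivative (ocf_shift a j) (at (x + t *\<^sub>R v)) v = 0"
    proof (rule frechet_derivative_eq_0_if_partials_eq_0[OF d])
      fix l assume l: "l < CARD('n)"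
      show "v $ ix (Suc l) = 0 \<or> partial_deriv (ix (Suc l)) (ocf_shift a j) (x + t *\<^sub>R v) = 0"
        using v partial_deriv_ocf_shift[where a = a, OF I I' _ l] by (cases "l < j") auto
    qed
  qed
qed

lemma diffeomorphism_on_shear:
  assumes I: "open I" "\<And>k. k < CARD('n) \<Longrightarrow> smooth_on I (a k)"
    and j: "j < CARD('n)" and W: "open W" "W \<subseteq> {x. x $ ix (Suc 0) \<in> I}"
  shows "diffeomorphism_on W (\<lambda>x. x - ocf_shift a j x *\<^sub>R axis (ix (Suc j)) 1)"
proof -
  let ?T = "{x. x $ ix (Suc 0) \<in> I}"
  have T: "open ?T" by (rule open_coordinate_cylinder[OF I(1)])
  have s: "smooth_on ?T (ocf_shift a j)"
    by (rule smooth_on_ocf_shift[where a = a, OF I less_imp_le[OF j]])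
  have axis: "(c *\<^sub>R axis (ix (Suc j)) (1::real)) $ ix (Suc l) = 0" if "l < j" for c l
    using that j coord_eq_iff[of j l] by (simp add: axis_def)
  have inv: "ocf_shift a j (x + c *\<^sub>R axis (ix (Suc j)) 1) = ocf_shift a j x" if "x \<in> ?T" for x c
    using that axis by (intro ocf_shift_add[where a = a, OF I j]) auto
  have mem: "x + ocf_shift a j y *\<^sub>R axis (ix (Suc j)) 1 \<in> ?T"
    "x - ocf_shift a j y *\<^sub>R axis (ix (Suc j)) 1 \<in> ?T" if "x \<in> ?T" for x y
  proof -
    have "(ocf_shift a j y *\<^sub>R axis (ix (Suc j)) (1::real)) $ ix (Suc 0) = 0"
      using axis[of 0] by (cases "j = 0") (simp_all add: ocf_shift_def)
    then show "x + ocf_shift a j y *\<^sub>R axis (ix (Suc j)) 1 \<in> ?T"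
      "x - ocf_shift a j y *\<^sub>R axis (ix (Suc j)) 1 \<in> ?T"
      using that by auto
  qed
  show ?thesis
  proof (rule diffeomorphism_onI[OF T W, where g = "\<lambda>x. x + ocf_shift a j x *\<^sub>R axis (ix (Suc j)) 1"])
    show "smooth_on ?T (\<lambda>x. x - ocf_shift a j x *\<^sub>R axis (ix (Suc j)) 1)"
      by (intro smooth_on_diff[OF T smooth_on_ident] smooth_on_scaleR[OF T s smooth_on_const])
    show "smooth_on ?T (\<lambda>x. x + ocf_shift a j x *\<^sub>R axis (ix (Suc j)) 1)"
      by (intro smooth_on_add[OF T smooth_on_ident] smooth_on_scaleR[OF T s smooth_on_const])
    fix x assume x: "x \<in> ?T"
    show "x - ocf_shift a j x *\<^sub>R axis (ix (Suc j)) 1 \<in> ?T \<and>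
        x - ocf_shift a j x *\<^sub>R axis (ix (Suc j)) 1 +
        ocf_shift a j (x - ocf_shift a j x *\<^sub>R axis (ix (Suc j)) 1) *\<^sub>R axis (ix (Suc j)) 1 = x"
      using mem[OF x] inv[OF x, of "- ocf_shift a j x"] by simp
    show "x + ocf_shift a j x *\<^sub>R axis (ix (Suc j)) 1 \<in> ?T \<and>
        x + ocf_shift a j x *\<^sub>R axis (ix (Suc j)) 1 -
        ocf_shift a j (x + ocf_shift a j x *\<^sub>R axis (ix (Suc j)) 1) *\<^sub>R axis (ix (Suc j)) 1 = x"
      using mem[OF x] inv[OF x, of "ocf_shift a j x"] by simp
  qed
qed

text \<open>The triangular map is the composition of the shears, the one of the highest index first.\<close>

lemma diffeomorphism_on_triangular:
  assumes I: "open I" "\<And>k. k < CARD('n) \<Longrightarrow> smooth_on I (a k)"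
    and W: "open W" "W \<subseteq> {x. x $ ix (Suc 0) \<in> I}" and k: "k \<le> CARD('n)"
  shows "diffeomorphism_on W
    (\<lambda>x. x - (\<Sum>j\<in>{CARD('n) - k..<CARD('n)}. ocf_shift a j x *\<^sub>R axis (ix (Suc j)) 1))"
  using k
proof (induction k)
  case 0
  have "diffeomorphism_on W (\<lambda>x. x)"
    by (rule diffeomorphism_onI[OF open_UNIV W(1) subset_UNIV smooth_on_ident smooth_on_ident]) auto
  then show ?case by simp
next
  case (Suc k)
  define m where "m = CARD('n) - Suc k"
  have m: "m < CARD('n)" "CARD('n) - k = Suc m"
    using Suc.prems by (auto simp: m_def)
  define r where "r x = (\<Sum>j\<in>{Suc m..<CARD('n)}. ocf_shift a j x *\<^sub>R axis (ix (Suc j)) (1::real))" for x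
  have r: "r x $ ix (Suc l) = 0" if "l \<le> m" for x l
    using that m(1) coord_eq_iff by (auto simp: r_def axis_def intro!: sum.neutral)
  have cyl: "x - r x \<in> {x. x $ ix (Suc 0) \<in> I}" if "x \<in> W" for x
    using that W(2) r[of 0 x] by auto
  have dr: "diffeomorphism_on W (\<lambda>x. x - r x)"
    using Suc.IH Suc.prems by (simp add: m(2) r_def)
  then have im: "open ((\<lambda>x. x - r x) ` W)"
    by (simp add: diffeomorphism_on_def)
  have "diffeomorphism_on ((\<lambda>x. x - r x) ` W) (\<lambda>y. y - ocf_shift a m y *\<^sub>R axis (ix (Suc m)) 1)"
    by (rule diffeomorphism_on_shear[where a = a, OF I(1) _ m(1) im]) (use I(2) cyl in auto)
  from diffeomorphism_on_compose[OF dr this]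
  have d: "diffeomorphism_on W (\<lambda>x. (x - r x) - ocf_shift a m (x - r x) *\<^sub>R axis (ix (Suc m)) 1)" .
  have "diffeomorphism_on W (\<lambda>x. x - (r x + ocf_shift a m x *\<^sub>R axis (ix (Suc m)) 1))"
  proof -
    have "(x - r x) - ocf_shift a m (x - r x) *\<^sub>R axis (ix (Suc m)) 1 =
        x - (r x + ocf_shift a m x *\<^sub>R axis (ix (Suc m)) 1)" if "x \<in> W" for x
      using ocf_shift_add[where a = a and x = x and v = "- r x", OF I m(1)] that W(2) r by auto
    then show ?thesis using diffeomorphism_on_cong[OF _ d] by simp
  qed
  moreover have "(\<Sum>j\<in>{CARD('n) - Suc k..<CARD('n)}. ocf_shift a j x *\<^sub>R axis (ix (Suc j)) (1::real)) =
      r x + ocf_shift a m x *\<^sub>R axis (ix (Suc m)) 1" for x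
    unfolding r_def m_def[symmetric] by (subst sum.atLeast_Suc_lessThan[OF m(1)]) (simp add: add.commute)
  ultimately show ?case by simp
qed

lemma diffeomorphism_on_reverse:
  assumes "open W"
  shows "diffeomorphism_on W (\<lambda>x. vec_of ix (\<lambda>k. x $ ix (Suc CARD('n) - k)))"
proof (rule diffeomorphism_onI[OF open_UNIV assms subset_UNIV])
  let ?r = "\<lambda>x :: real ^ 'n. vec_of ix (\<lambda>k. x $ ix (Suc CARD('n) - k))"
  show s: "smooth_on UNIV ?r"
  proof (rule smooth_on_vec[OF open_UNIV])
    fix i
    obtain j where "j < CARD('n)" "i = ix (Suc j)" by (rule coord_cases)
    then show "smooth_on UNIV (\<lambda>x. ?r x $ i)"
      using smooth_on_nth[OF open_UNIV] by simp
  qed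
  then show "smooth_on UNIV ?r" .
  have inv: "?r (?r x) = x" for x
  proof (rule vec_coord_eqI)
    fix j assume j: "j < CARD('n)"
    then have "CARD('n) - j = Suc (CARD('n) - Suc j)" "CARD('n) - Suc j < CARD('n)"
      "CARD('n) - (CARD('n) - Suc j) = Suc j" by auto
    then show "?r (?r x) $ ix (Suc j) = x $ ix (Suc j)"
      using j vec_of_coord[of "CARD('n) - Suc j"] by simp
  qed
  show "?r x \<in> UNIV \<and> ?r (?r x) = x" for x by (simp add: inv)
  then show "?r x \<in> UNIV \<and> ?r (?r x) = x" for x .
qed

lemma achieves_oel_on_if_sum_of_jets:
  assumes f: "smooth_on UNIV f" and h: "smooth_on UNIV h"
    and \<Psi>: "diffeomorphism_on V (obs_map ix f h)"
    and a: "\<And>i. i < CARD('n) \<Longrightarrow> smooth_on (h ` V) (a i)"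
    and p: "\<And>\<xi>. \<xi> \<in> V \<Longrightarrow> lie_pow CARD('n) f h \<xi> = (\<Sum>i<CARD('n). jet ix i (a i) (obs_map ix f h \<xi>))"
  shows "achieves_oel_on ix f h V"
proof -
  let ?n = "CARD('n)" and ?\<Psi> = "obs_map ix f h"
  have V: "open V" "open (?\<Psi> ` V)" using \<Psi> by (auto simp: diffeomorphism_on_def)
  have "h ` V = (\<lambda>x. x $ ix (Suc 0)) ` ?\<Psi> ` V" by (simp add: image_image)
  then have I: "open (h ` V)" using open_image_vec_nth[OF V(2)] by simp
  define t where "t x = x - (\<Sum>j\<in>{0..<?n}. ocf_shift a j x *\<^sub>R axis (ix (Suc j)) (1::real))" for x
  have t: "t x $ ix (Suc j) = x $ ix (Suc j) - ocf_shift a j x" if j: "j < ?n" for x j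
  proof -
    have "(\<Sum>l\<in>{0..<?n}. (ocf_shift a l x *\<^sub>R axis (ix (Suc l)) (1::real)) $ ix (Suc j)) =
        (\<Sum>l\<in>{0..<?n}. if l = j then ocf_shift a l x else 0)"
      by (intro sum.cong) (use j coord_eq_iff in \<open>auto simp: axis_def\<close>)
    then show ?thesis using j by (simp add: t_def)
  qed
  have dt: "diffeomorphism_on (?\<Psi> ` V) t"
  proof -
    have "?\<Psi> ` V \<subseteq> {x. x $ ix (Suc 0) \<in> h ` V}" by auto
    from diffeomorphism_on_triangular[where a = a and k = ?n, OF I a V(2) this]
    show ?thesis by (simp add: t_def[abs_def])
  qed
  define r where "r x = vec_of ix (\<lambda>k. x $ ix (Suc ?n - k))" for x :: "real ^ 'n"
  have "diffeomorphism_on V (\<lambda>\<xi>. t (?\<Psi> \<xi>))"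
    by (rule diffeomorphism_on_compose[OF \<Psi> dt])
  moreover from this have "diffeomorphism_on ((\<lambda>\<xi>. t (?\<Psi> \<xi>)) ` V) r"
    unfolding r_def[abs_def] by (intro diffeomorphism_on_reverse) (simp add: diffeomorphism_on_def)
  ultimately have \<Phi>: "diffeomorphism_on V (\<lambda>\<xi>. r (t (?\<Psi> \<xi>)))"
    by (rule diffeomorphism_on_compose)
  define \<Phi> where "\<Phi> \<xi> = r (t (?\<Psi> \<xi>))" for \<xi>
  have \<Phi>_coord: "\<Phi> \<xi> $ ix (Suc k) = lie_pow (?n - Suc k) f h \<xi> - ocf_shift a (?n - Suc k) (?\<Psi> \<xi>)"
    if "k < ?n" for \<xi> k
  proof -
    have "?n - k = Suc (?n - Suc k)" "?n - Suc k < ?n" using that by auto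
    then show ?thesis using that by (simp add: \<Phi>_def r_def t)
  qed
  have "transforms_to_ocf ix f h V \<Phi>"
    unfolding transforms_to_ocf_def ocf_C_inner
  proof (intro exI[of _ "\<lambda>k. a (k - 1)"] conjI ballI)
    fix k assume "k \<in> {1..?n}"
    then show "smooth_on (h ` V) (a (k - 1))" by (intro a) auto
  next
    fix \<xi> assume \<xi>: "\<xi> \<in> V"
    have h\<xi>: "h \<xi> \<in> h ` V" using \<xi> by simp
    obtain k where k: "?n = Suc k" by (metis finite_UNIV_card_ge_0 finite gr0_implies_Suc)
    show "h \<xi> = \<Phi> \<xi> $ ix ?n"
      using \<Phi>_coord[of k \<xi>] by (simp add: k ocf_shift_def)
    have \<Phi>\<xi>: "\<Phi> differentiable at \<xi>"
      using \<Phi> \<xi> smooth_on_differentiable unfolding diffeomorphism_on_def \<Phi>_def[abs_def] by blast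
    show "frechet_derivative \<Phi> (at \<xi>) (f \<xi>) = ocf_A ix *v \<Phi> \<xi> + vec_of ix (\<lambda>k. a (k - 1) (h \<xi>))"
    proof (rule vec_coord_eqI)
      fix k assume k: "k < ?n"
      define j where "j = ?n - Suc k"
      have j: "j < ?n" "?n - Suc j = k" "Suc j = ?n - k" using k by (auto simp: j_def)
      have d: "(\<lambda>\<xi>. ocf_shift a j (?\<Psi> \<xi>)) differentiable at \<xi>"
        using has_derivative_ocf_shift_obs_map[where a = a and f = f and h = h and I = "h ` V", OF f h I a h\<xi> less_imp_le[OF j(1)]]
        unfolding differentiable_def by auto
      have dl: "lie_pow j f h differentiable at \<xi>"
        using smooth_on_differentiable[OF smooth_on_lie_pow[OF open_UNIV f h]] by simp
      have "frechet_derivative \<Phi> (at \<xi>) (f \<xi>) $ ix (Suc k) = lie_deriv f (\<lambda>\<xi>. \<Phi> \<xi> $ ix (Suc k)) \<xi>"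
        using \<Phi>\<xi> differentiable_compose[OF bounded_linear_imp_differentiable[OF bounded_linear_vec_nth] \<Phi>\<xi>]
        by (simp add: lie_deriv_frechet frechet_derivative_nth)
      also have "\<dots> = lie_deriv f (\<lambda>\<xi>. lie_pow j f h \<xi> - ocf_shift a j (?\<Psi> \<xi>)) \<xi>"
        using k by (simp add: \<Phi>_coord j_def)
      also have "\<dots> = lie_pow (Suc j) f h \<xi> - ocf_shift a (Suc j) (?\<Psi> \<xi>) + a k (h \<xi>)"
        using lie_deriv_diff[OF dl d]
          lie_deriv_ocf_shift[where a = a and f = f and h = h and I = "h ` V", OF f h I a h\<xi> j(1)]
        by (simp add: lie_pow_Suc j(2))
      also have "lie_pow (Suc j) f h \<xi> - ocf_shift a (Suc j) (?\<Psi> \<xi>) = (ocf_A ix *v \<Phi> \<xi>) $ ix (Suc k)"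
        unfolding ocf_A_mult[OF k] j(3)
        using k \<Phi>_coord p[OF \<xi>] by (cases k) (auto simp: ocf_shift_def)
      finally show "frechet_derivative \<Phi> (at \<xi>) (f \<xi>) $ ix (Suc k) =
          (ocf_A ix *v \<Phi> \<xi> + vec_of ix (\<lambda>k. a (k - 1) (h \<xi>))) $ ix (Suc k)"
        using k by simp
    qed
  qed
  then show ?thesis
    using \<Phi> unfolding achieves_oel_on_def \<Phi>_def[abs_def] by blast
qed

lemma achieves_oel_on_if_pascal:
  assumes f: "smooth_on UNIV f" and h: "smooth_on UNIV h"
    and V: "connected V" "\<And>c. connected {\<xi> \<in> V. h \<xi> = c}"
    and \<Psi>: "diffeomorphism_on U (obs_map ix f h)" "open V" "V \<subseteq> U"
    and pascal: "pascal_hessian_on ix (obs_map ix f h ` U) (obs_p ix f h U)"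
  shows "achieves_oel_on ix f h V"
proof -
  let ?n = "CARD('n)" and ?\<Psi> = "obs_map ix f h"
  let ?W = "?\<Psi> ` V"
  have \<Psi>V: "diffeomorphism_on V ?\<Psi>" by (rule diffeomorphism_on_subset[OF \<Psi>])
  have cont: "continuous_on S ?\<Psi>" for S
    using smooth_on_continuous[OF smooth_on_obs_map[OF f h]] continuous_on_subset by blast
  have W: "open ?W" "connected ?W"
    using \<Psi>V connected_continuous_image[OF cont V(1)] by (auto simp: diffeomorphism_on_def)
  have slices: "connected {x \<in> ?W. x $ ix (Suc 0) = c}" for c
  proof -
    have "{x \<in> ?W. x $ ix (Suc 0) = c} = ?\<Psi> ` {\<xi> \<in> V. h \<xi> = c}" by auto
    then show ?thesis using connected_continuous_image[OF cont V(2)] by simp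
  qed
  have q: "smooth_on ?W (obs_p ix f h U)"
    by (rule smooth_on_subset[OF smooth_on_obs_p[OF f h \<Psi>(1)] image_mono[OF \<Psi>(3)]])
  have pa: "pascal_at (obs_p ix f h U) x" if "x \<in> ?W" for x
    using pascal that \<Psi>(3) unfolding pascal_hessian_on_iff by blast
  obtain k where k: "?n = Suc k" by (metis finite_UNIV_card_ge_0 finite gr0_implies_Suc)
  have im: "(\<lambda>x. x $ ix (Suc 0)) ` ?W = h ` V" by (simp add: image_image)
  obtain a where a: "\<forall>i\<le>k. smooth_on (h ` V) (a i)"
    "\<forall>x\<in>?W. obs_p ix f h U x = (\<Sum>i\<le>k. jet ix i (a i) x)"
    using sum_of_jets_if_pascal[OF W slices q pa, of k] k unfolding im by auto
  show ?thesis
  proof (rule achieves_oel_on_if_sum_of_jets[OF f h \<Psi>V])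
    show "smooth_on (h ` V) (a i)" if "i < ?n" for i
      using a(1) that k by simp
    fix \<xi> assume "\<xi> \<in> V"
    then have "lie_pow ?n f h \<xi> = obs_p ix f h U (?\<Psi> \<xi>)"
      using obs_p_obs_map[OF inj_on_diffeomorphism[OF \<Psi>(1)]] \<Psi>(3) by auto
    then show "lie_pow ?n f h \<xi> = (\<Sum>i<?n. jet ix i (a i) (?\<Psi> \<xi>))"
      using a(2) \<open>\<xi> \<in> V\<close> by (simp add: k lessThan_Suc_atMost)
  qed
qed

lemma locally_achieves_oel_iff_pascal:
  assumes f: "smooth_on UNIV f" and h: "smooth_on UNIV h" and U: "open U"
    and \<Psi>: "codistribution_full_on ix f h U \<Longrightarrow> diffeomorphism_on U (obs_map ix f h)"
  shows "(\<forall>\<xi>\<in>U. \<exists>V\<subseteq>U. \<xi> \<in> V \<and> region V \<and> achieves_oel_on ix f h V) \<longleftrightarrow>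
    codistribution_full_on ix f h U \<and> pascal_hessian_on ix (obs_map ix f h ` U) (obs_p ix f h U)"
    (is "?L \<longleftrightarrow> ?C \<and> ?P")
proof
  assume L: ?L
  have C: ?C
    unfolding codistribution_full_on_def
  proof
    fix \<xi> assume "\<xi> \<in> U"
    then obtain V \<Phi> where "\<xi> \<in> V" "diffeomorphism_on V \<Phi>" "transforms_to_ocf ix f h V \<Phi>"
      using L unfolding achieves_oel_on_def by blast
    then show "rank (codistribution_matrix ix f h \<xi>) = CARD('n)"
      using codistribution_full_on_if_transforms_to_ocf[OF f h] unfolding codistribution_full_on_def by blast
  qed
  moreover have ?P
    unfolding pascal_hessian_on_iff
  proof
    fix x assume "x \<in> obs_map ix f h ` U"
    then obtain \<xi> where \<xi>: "\<xi> \<in> U" "x = obs_map ix f h \<xi>" by blast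
    then obtain V \<Phi> where V: "\<xi> \<in> V" "V \<subseteq> U" "open V" "diffeomorphism_on V \<Phi>" "transforms_to_ocf ix f h V \<Phi>"
      using L unfolding achieves_oel_on_def region_def by blast
    show "pascal_at (obs_p ix f h U) x"
      using pascal_hessian_on_if_transforms_to_ocf[OF f h V(4,5) \<Psi>[OF C] V(3,2)] V(1) \<xi>(2)
      unfolding pascal_hessian_on_iff by blast
  qed
  ultimately show "?C \<and> ?P" ..
next
  assume R: "?C \<and> ?P"
  let ?\<Psi> = "obs_map ix f h"
  have d: "diffeomorphism_on U ?\<Psi>" using \<Psi> R by blast
  then obtain g where g: "open (?\<Psi> ` U)" "homeomorphism U (?\<Psi> ` U) ?\<Psi> g"
    unfolding diffeomorphism_on_def by blast
  have cont: "continuous_on UNIV ?\<Psi>"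
    by (rule smooth_on_continuous[OF smooth_on_obs_map[OF f h]])
  show ?L
  proof
    fix \<xi> assume \<xi>: "\<xi> \<in> U"
    then obtain e where e: "e > 0" "ball (?\<Psi> \<xi>) e \<subseteq> ?\<Psi> ` U"
      using g(1) open_contains_ball by blast
    let ?B = "ball (?\<Psi> \<xi>) e"
    define V where "V = g ` ?B"
    have "continuous_on (?\<Psi> ` U) g" using g(2) by (simp add: homeomorphism_def)
    then have cg: "continuous_on S g" if "S \<subseteq> ?B" for S
      using continuous_on_subset subset_trans[OF that e(2)] by blast
    have V_eq: "V = U \<inter> ?\<Psi> -` ?B"
      using g(2) e(2) unfolding V_def homeomorphism_def by force
    have "open (?\<Psi> -` ?B)"
      by (rule open_vimage[OF open_ball cont])
    then have V: "open V" "V \<subseteq> U" "\<xi> \<in> V" using U \<xi> e(1) unfolding V_eq by auto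
    have conn: "connected V"
      unfolding V_def by (rule connected_continuous_image[OF cg]) auto
    have "connected {\<zeta> \<in> V. h \<zeta> = c}" for c
    proof -
      let ?S = "?B \<inter> {x. x $ ix (Suc 0) = c}"
      have "h (g x) = x $ ix (Suc 0)" if "x \<in> ?B" for x
      proof -
        have "?\<Psi> (g x) = x" using homeomorphism_apply2[OF g(2)] that e(2) by blast
        then have "?\<Psi> (g x) $ ix (Suc 0) = x $ ix (Suc 0)" by simp
        then show ?thesis by simp
      qed
      then have "{\<zeta> \<in> V. h \<zeta> = c} = g ` ?S" by (auto simp: V_def)
      moreover have "convex {x :: real ^ 'n. x $ ix (Suc 0) = c}"
        by (auto simp: convex_def simp flip: distrib_right)
      then have "connected ?S" by (intro convex_connected convex_Int convex_ball)
      ultimately show ?thesis using connected_continuous_image[OF cg, of ?S] by simp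
    qed
    then have "achieves_oel_on ix f h V"
      using achieves_oel_on_if_pascal[OF f h conn _ d V(1,2)] R by blast
    then show "\<exists>V\<subseteq>U. \<xi> \<in> V \<and> region V \<and> achieves_oel_on ix f h V"
      using V conn unfolding region_def by blast
  qed
qed

end

theorem theorem2:
  fixes f :: "real ^ 'n::finite \<Rightarrow> real ^ 'n"
    and h :: "real ^ 'n \<Rightarrow> real"
    and ix :: "nat \<Rightarrow> 'n"
    and U :: "(real ^ 'n) set"
  assumes "bij_betw ix {1..CARD('n)} UNIV"
    and "smooth_on UNIV f" and "smooth_on UNIV h"
    and "region U"
    and "codistribution_full_on ix f h U \<Longrightarrow> diffeomorphism_on U (obs_map ix f h)"
  shows "((\<forall>c. connected {\<xi> \<in> U. h \<xi> = c}) \<longrightarrow>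
            (achieves_oel_on ix f h U \<longleftrightarrow>
               codistribution_full_on ix f h U \<and>
               pascal_hessian_on ix (obs_map ix f h ` U) (obs_p ix f h U))) \<and>
         ((\<forall>\<xi>\<in>U. \<exists>V\<subseteq>U. \<xi> \<in> V \<and> region V \<and> achieves_oel_on ix f h V) \<longleftrightarrow>
            codistribution_full_on ix f h U \<and>
            pascal_hessian_on ix (obs_map ix f h ` U) (obs_p ix f h U))"
proof -
  interpret coordinate_order ix by unfold_locales (rule assms(1))
  have U: "open U" "connected U" using assms(4) by (auto simp: region_def)
  note locally = locally_achieves_oel_iff_pascal[OF assms(2,3) U(1) assms(5)]
  show ?thesis
  proof (intro conjI impI locally)
    assume slices: "\<forall>c. connected {\<xi> \<in> U. h \<xi> = c}"
    show "achieves_oel_on ix f h U \<longleftrightarrow> codistribution_full_on ix f h U \<and>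
        pascal_hessian_on ix (obs_map ix f h ` U) (obs_p ix f h U)" (is "?A \<longleftrightarrow> ?R")
    proof
      assume ?A
      then have "\<forall>\<xi>\<in>U. \<exists>V\<subseteq>U. \<xi> \<in> V \<and> region V \<and> achieves_oel_on ix f h V"
        using assms(4) by blast
      then show ?R using locally by simp
    next
      assume ?R
      then show ?A
        using achieves_oel_on_if_pascal[OF assms(2,3) U(2) _ assms(5) U(1) subset_refl] slices by blast
    qed
  qed
qed

end
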